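(* Let $d, m$ be positive integers, $W$ a finite set, and $\Sigma=(\mathcal{K},\mathscr{L})$ a $d$-admissible selection structure on $W$. For every $w\in W$, let $X^w=\{x^w_1,\dots,x^w_m\}\subset\mathbb{R}^{d-1}$ be an (indexed) set of points. For every $w\in W$ and $i\in[m]$, let $A^w_i$ be a closed subset of $S^d$. Assume that: (1) for all $W'\subseteq W$ such that $W\setminus W'\notin\mathscr{L}$, we have $S^d=\bigcup_{w\in W'}\bigcup_{i=1}^m\left(A^w_i\cup(-A^w_i)\right)$; (2) for every pair of different elements $u,w\in W$ such that $\{u,w\}\in\mathcal{K}$ and every $i\in[m]$, we have $A^u_i\cap(-A^w_i)=\emptyset$. Then there exist $x\in S^d$ and two nonempty disjoint sets $P_+,P_-\subseteq W\times[m]$ such that: (a) $\operatorname{conv}\{x^w_i:(w,i)\in P_+\}\cap\operatorname{conv}\{x^w_i:(w,i)\in P_-\}\neq\emptyset$; (b) $x\in\left(\bigcap_{(w,i)\in P_+}A^w_i\right)\cap\left(\bigcap_{(w,i)\in P_-}(-A^w_i)\right)$; (c) the projection $\pi_1:P_+\cup P_-\to W$ onto the first coordinate is injective and $\pi_1(P_+\cup P_-)$ is a facet of $\mathcal{K}$; and the projection $\pi_2:W\times[m]\to[m]$ onto the second coordinate satisfies $\pi_2(P_+)\cap\pi_2(P_-)=\emptyset$.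
   Context: Notation: $[m]=\{1,\dots,m\}$; $S^d$ is the unit sphere in $\mathbb{R}^{d+1}$ and $-A=\{-x:x\in A\}$. A facet of a simplicial complex is an inclusion-maximal face. Let $W$ be a finite set, $\mathcal{K}$ a simplicial complex on $W$, and $D=\{D_w:w\in W\}$ an indexed family of nonempty finite sets (fibers). For $U\subseteq W$, let $\mathcal{K}[U]=\{\sigma\in\mathcal{K}:\sigma\subseteq U\}$. Define $\mathcal{K}(U;D)=\bigcup_{\sigma\in\mathcal{K}[U]}\left(\ast_{w\in\sigma}D_w\right)$, where $\ast$ denotes the iterated join of the discrete sets $D_w$ (fibers of different $w$ being regarded as disjoint). Equivalently, $\mathcal{K}(U;D)$ is the simplicial complex whose faces are the sets $\{(w,y_w):w\in\sigma\}$ with $\sigma\in\mathcal{K}[U]$ and $y_w\in D_w$ for each $w\in\sigma$. For a positive integer $d$, a pair $\Sigma=(\mathcal{K},\mathscr{L})$, where $\mathcal{K}$ is a simplicial complex on $W$ and $\mathscr{L}$ is a nonempty upward-closed family of subsets of $W$, is a $d$-admissible selection structure on $W$ if: (i) for every indexed family $D=\{D_w:w\in W\}$ of nonempty finite sets and every $U\in\mathscr{L}$, the complex $\mathcal{K}(U;D)$ is $(d-1)$-connected; and (ii) for every $U\in\mathscr{L}$, the facets of $\mathcal{K}[U]$ are also facets of $\mathcal{K}$. *)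

theory Defs
  imports "HOL-Analysis.Analysis" "HOL-Library.Function_Algebras"
begin

(* HOL-Analysis provides R^n and S^n for a variable n as topologies on nat => real
   (Euclidean_space, nsphere). The pointwise vector space structure makes the library's
   convex hull available there; in particular R^0 is covered. *)

instantiation "fun" :: (type, real_vector) real_vector
begin

definition "r *\<^sub>R f = (\<lambda>x. r *\<^sub>R f x)"

instance
  by standard (simp_all add: scaleR_fun_def fun_eq_iff scaleR_add_right scaleR_add_left)

end

definition simplicial_complex_on :: "'v set \<Rightarrow> 'v set set \<Rightarrow> bool" where
  "simplicial_complex_on V K \<longleftrightarrow>
     K \<subseteq> Pow V \<and> {} \<in> K \<and> (\<forall>\<sigma>\<in>K. \<forall>\<tau>. \<tau> \<subseteq> \<sigma> \<longrightarrow> \<tau> \<in> K)"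

definition facets :: "'v set set \<Rightarrow> 'v set set" where
  "facets K = {\<sigma> \<in> K. \<forall>\<tau>\<in>K. \<sigma> \<subseteq> \<tau> \<longrightarrow> \<tau> = \<sigma>}"

definition induced_complex :: "'v set set \<Rightarrow> 'v set \<Rightarrow> 'v set set" where
  "induced_complex K U = {\<sigma> \<in> K. \<sigma> \<subseteq> U}"

(* Barycentric coordinates with the product topology; this is the usual topology for
   finite complexes, which are the only ones occurring below. *)

definition geometric_realization :: "'v set set \<Rightarrow> ('v \<Rightarrow> real) topology" where
  "geometric_realization K = subtopology (powertop_real UNIV)
     {f. (\<forall>v. 0 \<le> f v) \<and> {v. f v \<noteq> 0} \<in> K \<and> (\<Sum>v | f v \<noteq> 0. f v) = 1}"

definition nball :: "nat \<Rightarrow> (nat \<Rightarrow> real) topology" where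
  "nball n = subtopology (Euclidean_space n) {x. (\<Sum>i<n. (x i)\<^sup>2) \<le> 1}"

(* Nonemptiness is the extension condition for the empty sphere of dimension -1. *)

definition n_connected :: "nat \<Rightarrow> 'a topology \<Rightarrow> bool" where
  "n_connected n X \<longleftrightarrow> topspace X \<noteq> {} \<and>
     (\<forall>k\<le>n. \<forall>f. continuous_map (nsphere k) X f \<longrightarrow>
        (\<exists>g. continuous_map (nball (Suc k)) X g \<and> (\<forall>x\<in>topspace (nsphere k). g x = f x)))"

definition fiber_complex :: "'w set set \<Rightarrow> 'w set \<Rightarrow> ('w \<Rightarrow> 'b set) \<Rightarrow> ('w \<times> 'b) set set" where
  "fiber_complex K U D =
     {(\<lambda>w. (w, y w)) ` \<sigma> | \<sigma> y. \<sigma> \<in> induced_complex K U \<and> (\<forall>w\<in>\<sigma>. y w \<in> D w)}"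

(* Fibers are taken inside nat: every finite set is in bijection with a set of naturals,
   and relabelling fibers does not change the complex up to isomorphism. *)

definition admissible_selection_structure ::
    "nat \<Rightarrow> 'w set \<Rightarrow> 'w set set \<Rightarrow> 'w set set \<Rightarrow> bool" where
  "admissible_selection_structure d W K L \<longleftrightarrow>
     0 < d \<and>
     simplicial_complex_on W K \<and>
     L \<subseteq> Pow W \<and> L \<noteq> {} \<and> (\<forall>U\<in>L. \<forall>V. U \<subseteq> V \<and> V \<subseteq> W \<longrightarrow> V \<in> L) \<and>
     (\<forall>D :: 'w \<Rightarrow> nat set. (\<forall>w\<in>W. finite (D w) \<and> D w \<noteq> {}) \<longrightarrow>
        (\<forall>U\<in>L. n_connected (d - 1) (geometric_realization (fiber_complex K U D)))) \<and>
     (\<forall>U\<in>L. facets (induced_complex K U) \<subseteq> facets K)"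

end

theory Submission
  imports Defs "HOL-Homology.Homology"
begin

text \<open>
  The theorem is a Radon-type statement with a continuous parameter in the sphere, and its engine is
  a Borsuk-Ulam argument for a set-valued map. Number the two signed copies of the index \<open>i\<close>
  by \<open>2 * i\<close> (for \<open>A w i\<close>) and \<open>2 * i + 1\<close> (for \<open>- A w i\<close>), so that \<open>flip\<close>, which
  exchanges the two, is the antipode on labels. A point \<open>x\<close> of the sphere has a
  set of active labels over every \<open>w\<close>, namely the signed sets that contain \<open>x\<close>. The covering
  hypothesis says exactly that the elements \<open>w\<close> with an active label form a member of \<open>L\<close>, so the
  fiber complex over \<open>K\<close> spanned by the active labels is \<open>(d - 1)\<close>-connected. On its realization
  there is the affine map that sends the vertex over \<open>w\<close> with index \<open>i\<close> and sign \<open>s\<close> to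
  \<open>s * (X w i, 1)\<close> in \<open>d\<close>-dimensional space. This map is odd, and a zero of it is a
  coincidence between a convex combination of points with positive sign and one of points with
  negative sign. Such a zero therefore gives the two sets of the theorem, except that they project
  only to a face; completing the face to a facet with further active labels only enlarges the hulls.
  Two opposite labels with the same index cannot occur on one face, by the disjointness hypothesis.

  A zero exists at some \<open>x\<close> for the following reason (\<open>borsuk_ulam_carrier\<close>). The \<open>d\<close>-sphere
  supports an antipodal tower (\<open>antipodal_tower_nsphere\<close>): singular chains \<open>c 0, ..., c d\<close>, starting
  with a point, in which the boundary of \<open>c (k + 1)\<close> is \<open>c k\<close> plus or minus its antipode; these are
  the hemispheres. Towers can be subdivided and pushed forward along equivariant maps. Instead of a
  map defined on the sphere, one chooses for every singular simplex of the sphere a singular simplex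
  in the realization of the complex of those labels that are active somewhere on it; connectedness
  allows this choice to be made compatibly with faces and with the antipode
  (\<open>equivariant_selection\<close>), because a compatible family on the faces extends over the simplex
  (\<open>simplex_extension\<close>). As the sets are closed, a sufficiently small simplex meets only
  sets containing one common point \<open>x\<close>. If the odd map never vanished, the push-forward of the
  subdivided tower would be a tower of height \<open>d\<close> in \<open>d\<close>-dimensional space without the origin.

  That is impossible (\<open>no_antipodal_tower_punctured_space\<close>) by Fan's parity argument. Label a
  point by the coordinate of largest absolute value and its sign. After subdivision no simplex carries
  two complementary labels. Modulo 2, the number of simplices of the \<open>k\<close>-th chain, counted with
  coefficients, whose labels alternate in sign does not depend on \<open>k\<close>; it is 1 for \<open>k = 0\<close>, whereas \<open>d + 1\<close> vertices cannot
  alternate with labels from only \<open>d\<close> coordinates.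
\<close>

section \<open>Alternating label sequences\<close>

fun alternating :: "bool \<Rightarrow> bool list \<Rightarrow> bool" where
  "alternating s [] = True"
| "alternating s (x # xs) = (x = s \<and> alternating (\<not> s) xs)"

definition delete_nth :: "nat \<Rightarrow> 'a list \<Rightarrow> 'a list" where
  "delete_nth i xs = take i xs @ drop (Suc i) xs"

lemma delete_nth_Cons [simp]:
  "delete_nth 0 (x # xs) = xs" "delete_nth (Suc i) (x # xs) = x # delete_nth i xs"
  by (simp_all add: delete_nth_def)

lemma map_delete_nth: "map f (delete_nth i xs) = delete_nth i (map f xs)"
  by (simp add: delete_nth_def take_map drop_map)

lemma mset_delete_nth: "i < length xs \<Longrightarrow> mset (delete_nth i xs) = mset xs - {#xs ! i#}"
proof -
  assume i: "i < length xs"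
  have "mset xs = mset (take i xs @ xs ! i # drop (Suc i) xs)"
    using id_take_nth_drop[OF i] by simp
  then show ?thesis by (simp add: delete_nth_def)
qed

lemma sorted_delete_nth: "sorted xs \<Longrightarrow> sorted (delete_nth i xs)"
proof -
  assume "sorted xs"
  then have "sorted (take i xs @ drop i xs)" "sorted (drop (Suc i) xs)"
    by (simp_all add: sorted_wrt_drop)
  moreover have "set (drop (Suc i) xs) \<subseteq> set (drop i xs)"
    by (simp add: set_drop_subset_set_drop)
  ultimately show ?thesis
    unfolding delete_nth_def sorted_append by blast
qed

text \<open>
  An alternating sequence has exactly one deletion that alternates with first sign \<open>s\<close>:
  that of its first or of its last entry. A sequence with exactly one pair of equal neighbours has
  two such deletions or none, and any other sequence has none.
\<close>
lemma alternating_deletions: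
  "even ((\<Sum>i<length xs. of_bool (alternating s (delete_nth i xs)))
     + of_bool (alternating s xs) + of_bool (alternating (\<not> s) xs) :: int)"
proof (induction xs arbitrary: s)
  case Nil
  then show ?case by simp
next
  case (Cons x xs)
  show ?case
    using Cons[of "\<not> s"]
    by (cases "x = s") (auto simp: sum.lessThan_Suc_shift simp del: sum.lessThan_Suc)
qed

lemma alternating_map_Not: "alternating (\<not> s) (map Not xs) = alternating s xs"
proof (induction xs arbitrary: s)
  case (Cons x xs)
  show ?case using Cons[of "\<not> s"] by auto
qed simp

text \<open>
  The label \<open>2 * j\<close> stands for the sign plus and \<open>2 * j + 1\<close> for the sign minus at position \<open>j\<close>.
  With this coding the usual order of the natural numbers sorts labels by position.
\<close>
definition flip :: "nat \<Rightarrow> nat" where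
  "flip n = (if even n then Suc n else n - 1)"

lemma flip_flip [simp]: "flip (flip n) = n"
  by (auto simp: flip_def elim: oddE)

lemma even_flip [simp]: "even (flip n) \<longleftrightarrow> odd n"
  by (auto simp: flip_def)

lemma flip_div_2 [simp]: "flip n div 2 = n div 2"
  by (auto simp: flip_def elim: oddE)

lemma flip_mono: "m \<le> n \<Longrightarrow> n \<noteq> flip m \<Longrightarrow> flip m \<le> flip n"
  unfolding flip_def by presburger

text \<open>
  Listed by increasing position, the labels alternate in sign, the first one being positive iff
  \<open>s\<close>. These are the alternating simplices in Fan's combinatorial lemma.
\<close>
definition fan :: "bool \<Rightarrow> nat list \<Rightarrow> bool" where
  "fan s L \<longleftrightarrow> alternating s (map even (sort L))"

text \<open>
  Alternation depends only on the multiset of labels, so the count over all deletions can be made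
  on the sorted list. As a statement on cochains: the
  coboundary of the indicator of \<open>fan True\<close> is the sum of the indicators for the two signs.
\<close>
lemma fan_deletions:
  "even ((\<Sum>i<length L. of_bool (fan s (delete_nth i L)))
     + of_bool (fan s L) + of_bool (fan (\<not> s) L) :: int)"
proof -
  define H where "H M = (of_bool (alternating s (map even (sorted_list_of_multiset M))) :: int)" for M :: "nat multiset"
  have H: "(of_bool (fan s L) :: int) = H (mset L)" for L :: "nat list"
    by (simp add: H_def fan_def)
  have sum: "(\<Sum>i<length L. of_bool (fan s (delete_nth i L)) :: int)
      = (\<Sum>x\<in>#mset L. H (mset L - {#x#}))" for L :: "nat list"
  proof -
    have "(\<Sum>i<length L. of_bool (fan s (delete_nth i L)) :: int)
        = (\<Sum>i<length L. H (mset L - {#L ! i#}))"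
      by (intro sum.cong refl) (simp add: H mset_delete_nth)
    also have "\<dots> = sum_list (map (\<lambda>x. H (mset L - {#x#})) L)"
      by (simp add: sum_list_sum_nth atLeast0LessThan)
    also have "\<dots> = (\<Sum>x\<in>#mset L. H (mset L - {#x#}))"
      by (metis mset_map sum_mset_sum_list)
    finally show ?thesis .
  qed
  have "(\<Sum>i<length L. of_bool (fan s (delete_nth i L)) :: int)
      = (\<Sum>i<length (sort L). of_bool (fan s (delete_nth i (sort L))))"
    unfolding sum by simp
  also have "\<dots> = (\<Sum>i<length (map even (sort L)).
      of_bool (alternating s (delete_nth i (map even (sort L)))))"
    by (simp add: fan_def sorted_delete_nth sorted_sort_id map_delete_nth)
  finally show ?thesis
    using alternating_deletions[of s "map even (sort L)"] by (simp add: fan_def)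
qed

definition no_complementary :: "nat list \<Rightarrow> bool" where
  "no_complementary L \<longleftrightarrow> (\<forall>x\<in>set L. flip x \<notin> set L)"

text \<open>
  Exchanging the signs keeps the order of the labels, except possibly that of a complementary pair.
\<close>
lemma fan_map_flip:
  assumes "no_complementary L"
  shows "fan s (map flip L) = fan (\<not> s) L"
proof -
  have "sorted_wrt (\<lambda>x y. flip x \<le> flip y) (sort L)"
    by (rule sorted_wrt_mono_rel[where P = "(\<le>)"])
      (use assms in \<open>auto simp: no_complementary_def intro: flip_mono\<close>)
  then have "sorted (map flip (sort L))"
    by (simp add: sorted_wrt_map)
  then have "sort (map flip L) = map flip (sort L)"
    by (metis mset_map mset_sort sorted_sort_id sorted_list_of_multiset_mset)
  then have "map even (sort (map flip L)) = map Not (map even (sort L))"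
    by simp
  then show ?thesis
    unfolding fan_def using alternating_map_Not[of "\<not> s" "map even (sort L)"] by simp
qed

lemma alternating_sorted_strict:
  assumes "sorted xs" "alternating s (map even xs)" "\<forall>x\<in>set xs. flip x \<notin> set xs"
  shows "sorted_wrt (<) (map (\<lambda>n. n div 2) xs)"
  using assms
proof (induction xs arbitrary: s rule: induct_list012)
  case (3 x y zs)
  have IH: "sorted_wrt (<) (map (\<lambda>n. n div 2) (y # zs))"
    using 3(2)[of "\<not> s"] 3(3-5) by auto
  have "x \<le> y" "even x \<noteq> even y" "y \<noteq> flip x"
    using 3(3-5) by auto
  then have "x div 2 < y div 2"
    unfolding flip_def by presburger
  then show ?case using IH by (auto intro: less_trans)
qed auto

text \<open>
  Consecutive labels have opposite signs and are not complementary, so their positions increase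
  strictly; there are only \<open>d\<close> positions.
\<close>
lemma fan_length:
  assumes "no_complementary L" "fan s L" "\<forall>x\<in>set L. x < 2 * d"
  shows "length L \<le> d"
proof -
  let ?q = "map (\<lambda>n. n div 2) (sort L)"
  have "distinct ?q"
    using alternating_sorted_strict[of "sort L" s] assms
    by (auto simp: fan_def no_complementary_def strict_sorted_iff)
  moreover have "set ?q \<subseteq> {..<d}" using assms(3) by auto
  ultimately show ?thesis
    by (metis card_lessThan card_mono distinct_card finite_lessThan length_map length_sort)
qed

section \<open>Antipodal towers of singular chains\<close>

text \<open>
  The chain \<open>c k\<close> plays the role of a \<open>k\<close>-dimensional hemisphere and the right hand side of the
  boundary condition that of its equatorial sphere. Algebraically, a tower is an equivariant chain map
  from the standard resolution of the group of order two, truncated above degree \<open>n\<close>.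
\<close>
definition antipodal_tower ::
    "nat \<Rightarrow> 'a topology \<Rightarrow> ('a \<Rightarrow> 'a) \<Rightarrow> (nat \<Rightarrow> 'a chain) \<Rightarrow> bool" where
  "antipodal_tower n X a c \<longleftrightarrow>
     (\<exists>f. c 0 = frag_of f) \<and> (\<forall>k\<le>n. singular_chain k X (c k)) \<and>
     (\<forall>k<n. chain_boundary (Suc k) (c (Suc k))
        = c k + frag_cmul ((-1) ^ Suc k) (chain_map k a (c k)))"

lemma singular_subdivision_sign:
  "singular_subdivision p (frag_cmul ((-1) ^ k) c) = frag_cmul ((-1) ^ k) (singular_subdivision p c)"
  by (simp add: singular_subdivision_def frag_extend_cmul)

lemma antipodal_tower_subdivision:
  assumes "antipodal_tower n X a c" "continuous_map X X a"
  shows "antipodal_tower n X a (\<lambda>k. (singular_subdivision k ^^ r) (c k))"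
proof (induction r)
  case 0
  then show ?case using assms by simp
next
  case (Suc r)
  define e where "e k = (singular_subdivision k ^^ r) (c k)" for k
  have e: "antipodal_tower n X a e" using Suc by (simp add: e_def[abs_def])
  have "antipodal_tower n X a (\<lambda>k. singular_subdivision k (e k))"
    unfolding antipodal_tower_def
  proof (intro conjI allI impI)
    show "\<exists>f. singular_subdivision 0 (e 0) = frag_of f"
    proof -
      have "singular_chain 0 X (e 0)" "\<exists>f. e 0 = frag_of f"
        using e unfolding antipodal_tower_def by blast+
      then show ?thesis by (metis singular_subdivision_zero)
    qed
    show "singular_chain k X (singular_subdivision k (e k))" if "k \<le> n" for k
    proof -
      have "singular_chain k X (e k)" using e that unfolding antipodal_tower_def by blast
      then show ?thesis by (rule singular_chain_singular_subdivision)
    qed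
    show "chain_boundary (Suc k) (singular_subdivision (Suc k) (e (Suc k)))
        = singular_subdivision k (e k)
          + frag_cmul ((-1) ^ Suc k) (chain_map k a (singular_subdivision k (e k)))"
      if "k < n" for k
    proof -
      have "singular_chain (Suc k) X (e (Suc k))" "singular_chain k X (e k)"
        and "chain_boundary (Suc k) (e (Suc k))
          = e k + frag_cmul ((-1) ^ Suc k) (chain_map k a (e k))"
        using e that unfolding antipodal_tower_def by (metis Suc_leI less_imp_le_nat)+
      then show ?thesis
        by (simp only: chain_boundary_singular_subdivision diff_Suc_Suc diff_zero singular_subdivision_add
            singular_subdivision_sign naturality_singular_subdivision)
    qed
  qed
  then show ?case by (simp add: e_def)
qed

text \<open>
  Barycentric subdivision commutes with boundaries and with induced maps, so it maps towers to
  towers; it has to be iterated often enough for the finitely many degrees simultaneously.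
\<close>
lemma antipodal_tower_small:
  assumes tower: "antipodal_tower n X a c" "continuous_map X X a"
    and cover: "\<And>U. U \<in> \<C> \<Longrightarrow> openin X U" "topspace X \<subseteq> \<Union>\<C>"
  obtains e where "antipodal_tower n X a e"
    "\<And>k f. k \<le> n \<Longrightarrow> f \<in> Poly_Mapping.keys (e k) \<Longrightarrow> \<exists>V\<in>\<C>. f ` standard_simplex k \<subseteq> V"
proof -
  have "\<exists>r. \<forall>m\<ge>r. \<forall>f\<in>Poly_Mapping.keys ((singular_subdivision k ^^ m) (c k)).
          \<exists>V\<in>\<C>. f \<in> standard_simplex k \<rightarrow> V" if "k \<le> n" for k
  proof -
    have "singular_chain k X (c k)"
      using tower(1) that by (simp add: antipodal_tower_def)
    show ?thesis
    proof (rule sufficient_iterated_singular_subdivision_exists[of \<C> X k "c k"])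
      fix r assume r: "\<And>m f. \<lbrakk>r \<le> m; f \<in> Poly_Mapping.keys ((singular_subdivision k ^^ m) (c k))\<rbrakk>
        \<Longrightarrow> \<exists>V\<in>\<C>. f \<in> standard_simplex k \<rightarrow> V"
      show ?thesis using r by (intro exI[of _ r]) simp
    qed (use cover \<open>singular_chain k X (c k)\<close> in auto)
  qed
  then have "\<forall>k\<in>{..n}. \<exists>r. \<forall>m\<ge>r. \<forall>f\<in>Poly_Mapping.keys ((singular_subdivision k ^^ m) (c k)).
          \<exists>V\<in>\<C>. f \<in> standard_simplex k \<rightarrow> V"
    by simp
  from bchoice[OF this] obtain r where r: "\<forall>k\<in>{..n}. \<forall>m\<ge>r k.
      \<forall>f\<in>Poly_Mapping.keys ((singular_subdivision k ^^ m) (c k)).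
      \<exists>V\<in>\<C>. f \<in> standard_simplex k \<rightarrow> V"
    by (elim exE)
  define m where "m = Max (r ` {..n})"
  have m: "m \<ge> r k" if "k \<le> n" for k
    unfolding m_def using that by (intro Max_ge) auto
  show ?thesis
  proof (rule that[OF antipodal_tower_subdivision[OF tower, of m]])
    fix k f assume "k \<le> n" "f \<in> Poly_Mapping.keys ((singular_subdivision k ^^ m) (c k))"
    then have "\<exists>V\<in>\<C>. f \<in> standard_simplex k \<rightarrow> V"
      using r m[of k] by blast
    then show "\<exists>V\<in>\<C>. f ` standard_simplex k \<subseteq> V" by (auto simp: image_subset_iff)
  qed
qed

text \<open>
  The simplexwise map \<open>\<phi>\<close> need not come from a map of spaces: compatibility with faces and
  with the antipode is all that is needed for its linear extension to preserve the defining equations.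
\<close>
lemma antipodal_tower_image:
  assumes tower: "antipodal_tower d X a c"
    and simplex: "\<And>k \<sigma>. k \<le> d \<Longrightarrow> \<sigma> \<in> Poly_Mapping.keys (c k) \<Longrightarrow> singular_simplex k Y (\<phi> k \<sigma>)"
    and equi: "\<And>k \<sigma>. k \<le> d \<Longrightarrow> singular_simplex k X \<sigma> \<Longrightarrow>
       \<phi> k (simplex_map k a \<sigma>) = simplex_map k b (\<phi> k \<sigma>)"
    and face: "\<And>k \<sigma> i. k < d \<Longrightarrow> singular_simplex (Suc k) X \<sigma> \<Longrightarrow> i \<le> Suc k \<Longrightarrow>
       singular_face (Suc k) i (\<phi> (Suc k) \<sigma>) = \<phi> k (singular_face (Suc k) i \<sigma>)"
  shows "antipodal_tower d Y b (\<lambda>k. frag_extend (frag_of \<circ> \<phi> k) (c k))"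
  unfolding antipodal_tower_def
proof (intro conjI allI impI)
  let ?F = "\<lambda>k. frag_extend (frag_of \<circ> \<phi> k)"
  have chain: "singular_chain k X (c k)" if "k \<le> d" for k
    using tower that by (simp add: antipodal_tower_def)
  obtain f where "c 0 = frag_of f" using tower by (auto simp: antipodal_tower_def)
  then show "\<exists>f. ?F 0 (c 0) = frag_of f" by auto
  show "singular_chain k Y (?F k (c k))" if "k \<le> d" for k
    using simplex[OF that] by (intro singular_chain_extend) (simp add: singular_chain_of)
  show "chain_boundary (Suc k) (?F (Suc k) (c (Suc k)))
      = ?F k (c k) + frag_cmul ((-1) ^ Suc k) (chain_map k b (?F k (c k)))" if "k < d" for k
  proof -
    have boundary: "chain_boundary (Suc k) (?F (Suc k) e) = ?F k (chain_boundary (Suc k) e)"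
      if "Poly_Mapping.keys e \<subseteq> singular_simplex_set (Suc k) X" for e
      using that
    proof (induction e rule: frag_induction)
      case (one \<sigma>)
      then show ?case
        using face[OF \<open>k < d\<close>, of \<sigma>]
        by (simp add: chain_boundary_of frag_extend_sum frag_extend_cmul o_def del: sum.atMost_Suc)
    qed (simp_all add: chain_boundary_diff frag_extend_diff)
    have antipode: "?F k (chain_map k a e) = chain_map k b (?F k e)"
      if "Poly_Mapping.keys e \<subseteq> singular_simplex_set k X" for e
      using that
    proof (induction e rule: frag_induction)
      case (one \<sigma>)
      then show ?case using equi[of k \<sigma>] \<open>k < d\<close> by simp
    qed (simp_all add: chain_map_diff frag_extend_diff)
    have "chain_boundary (Suc k) (c (Suc k)) = c k + frag_cmul ((-1) ^ Suc k) (chain_map k a (c k))"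
      using tower that by (simp add: antipodal_tower_def)
    then show ?thesis
      using boundary[of "c (Suc k)"] antipode[of "c k"] chain[of k] chain[of "Suc k"] that
      by (simp add: singular_chain_def frag_extend_add frag_extend_cmul)
  qed
qed

text \<open>
  The two closed hemispheres are contractible, and they meet if \<open>d\<close> is positive.
\<close>
lemma path_connected_nsphere:
  assumes "0 < d"
  shows "path_connected_space (nsphere d)"
proof -
  let ?A = "topspace (nsphere d) \<inter> {x. 0 \<le> x d}" and ?B = "topspace (nsphere d) \<inter> {x. x d \<le> 0}"
  have "path_connectedin (nsphere d) ?A"
    using contractible_imp_path_connected_space[OF contractible_space_upper_hemisphere[of d d]]
    by (simp add: path_connectedin_def subtopology_restrict)
  moreover have "path_connectedin (nsphere d) ?B"
    using contractible_imp_path_connected_space[OF contractible_space_lower_hemisphere[of d d]]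
    by (simp add: path_connectedin_def subtopology_restrict)
  moreover have "(\<lambda>n. if n = 0 then 1 else 0) \<in> ?A \<inter> ?B"
    using in_topspace_nsphere[of d] assms by simp
  ultimately have "path_connectedin (nsphere d) (?A \<union> ?B)"
    by (intro path_connectedin_Un) auto
  moreover have "?A \<union> ?B = topspace (nsphere d)" by auto
  ultimately show ?thesis by (simp add: path_connectedin_topspace)
qed

lemma nsphere_cycle_is_boundary:
  assumes "0 < k" "k < d" "singular_relcycle k (nsphere d) {} z"
  shows "singular_relboundary k (nsphere d) {} z"
proof -
  have "trivial_group (reduced_homology_group (int k) (nsphere d))"
    using assms by (simp add: trivial_reduced_homology_group_nsphere)
  then have "trivial_group (homology_group (int k) (nsphere d))"
    using assms by (simp add: un_reduced_homology_group)
  moreover have "homologous_rel_set k (nsphere d) {} z \<in> carrier (homology_group (int k) (nsphere d))"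
    using assms by (auto simp: carrier_relative_homology_group)
  ultimately have "homologous_rel_set k (nsphere d) {} z = singular_relboundary_set k (nsphere d) {}"
    by (simp add: trivial_group_def)
  then show ?thesis by (simp add: homologous_rel_set_eq_relboundary)
qed

lemma continuous_map_nsphere_antipode: "continuous_map (nsphere d) (nsphere d) uminus"
  unfolding nsphere continuous_map_in_subtopology continuous_map_componentwise_UNIV
  by (auto intro!: continuous_map_minus continuous_map_from_subtopology continuous_map_product_projection)

text \<open>
  The tower is built degree by degree. The right hand side of the boundary condition is a
  cycle because of the alternating sign, and below dimension \<open>d\<close> the sphere has no reduced homology,
  so this cycle bounds.
\<close>
lemma antipodal_tower_nsphere:
  assumes "0 < d"
  obtains c where "antipodal_tower d (nsphere d) uminus c"
proof -
  let ?S = "nsphere d"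
  \<comment> \<open>the equatorial cycle of the hemisphere \<open>c\<close>\<close>
  let ?z = "\<lambda>k c. c + frag_cmul ((-1) ^ Suc k) (chain_map k uminus c)"
  define f0 where "f0 = (\<lambda>x\<in>standard_simplex 0. \<lambda>n::nat. if n = 0 then 1 else (0::real))"
  have f0: "singular_simplex 0 ?S f0"
    unfolding singular_simplex_def f0_def
    by (simp add: in_topspace_nsphere)
  define P where "P k c \<longleftrightarrow> (k = 0 \<longrightarrow> c = frag_of f0) \<and>
     (k \<le> d \<longrightarrow> singular_chain k ?S c \<and> singular_relcycle k ?S {} (?z k c))" for k c
  define Q where "Q k c c' \<longleftrightarrow> (k < d \<longrightarrow> chain_boundary (Suc k) c' = ?z k c)"
    for k and c c' :: "(nat \<Rightarrow> real) chain"
  have "P 0 (frag_of f0)"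
    using f0 singular_simplex_simplex_map[OF f0 continuous_map_nsphere_antipode]
    by (simp add: P_def singular_cycle singular_chain_of singular_chain_diff chain_boundary_def)
  moreover have "\<exists>c'. P (Suc k) c' \<and> Q k c c'" if P: "P k c" for k c
  proof (cases "k < d")
    case False
    then show ?thesis by (auto simp: P_def Q_def)
  next
    case True
    have c: "singular_chain k ?S c" "singular_relcycle k ?S {} (?z k c)"
      using P True by (auto simp: P_def)
    have "singular_relboundary k ?S {} (?z k c)"
    proof (cases "k = 0")
      case True
      have "homologous_rel 0 ?S {} (frag_of f0) (frag_of (simplex_map 0 uminus f0))"
        using singular_simplex_simplex_map[OF f0 continuous_map_nsphere_antipode]
        by (intro iso_integer_zeroth_homology_group_aux path_connected_nsphere assms f0)
      then show ?thesis using P True by (simp add: P_def homologous_rel_def)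
    qed (use nsphere_cycle_is_boundary c \<open>k < d\<close> in blast)
    then obtain c' where c': "singular_chain (Suc k) ?S c'" "chain_boundary (Suc k) c' = ?z k c"
      unfolding singular_boundary by blast
    have sign: "frag_cmul ((-1) ^ Suc k) (frag_cmul ((-1) ^ Suc k) e) = e" for e :: "(nat \<Rightarrow> real) chain"
      by (simp add: flip: power_mult_distrib)
    have involution: "chain_map k uminus (chain_map k uminus c) = c"
    proof -
      have "chain_map k uminus (chain_map k uminus c) = chain_map k (uminus \<circ> uminus) c"
        by (simp only: chain_map_compose o_apply)
      also have "\<dots> = c" by (rule chain_map_id_gen[OF c(1)]) simp
      finally show ?thesis .
    qed
    have "chain_boundary (Suc k) (?z (Suc k) c')
        = ?z k c + frag_cmul ((-1) ^ Suc (Suc k)) (chain_map k uminus (?z k c))"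
      using c' chain_boundary_chain_map[OF c'(1), of uminus]
      by (simp add: chain_boundary_add chain_boundary_cmul)
    also have "\<dots> = ?z k c - frag_cmul ((-1) ^ Suc k) (chain_map k uminus c
          + frag_cmul ((-1) ^ Suc k) c)"
      by (simp add: chain_map_add involution)
    also have "\<dots> = 0"
      by (simp add: frag_cmul_distrib2 sign)
    finally have "singular_relcycle (Suc k) ?S {} (?z (Suc k) c')"
      using c'(1) singular_chain_chain_map[OF c'(1) continuous_map_nsphere_antipode]
      by (simp add: singular_cycle singular_chain_add singular_chain_cmul)
    then show ?thesis using c' by (auto simp: P_def Q_def)
  qed
  ultimately obtain c where c: "\<And>k. P k (c k)" "\<And>k. Q k (c k) (c (Suc k))"
    using dependent_nat_choice[of P Q] by blast
  have "antipodal_tower d ?S uminus c"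
    unfolding antipodal_tower_def
  proof (intro conjI allI impI)
    show "\<exists>f. c 0 = frag_of f" using c(1)[of 0] by (auto simp: P_def)
    show "singular_chain k ?S (c k)" if "k \<le> d" for k using c(1)[of k] that by (simp add: P_def)
    show "chain_boundary (Suc k) (c (Suc k)) = ?z k (c k)" if "k < d" for k
      using c(2)[of k] that by (simp add: Q_def)
  qed
  then show ?thesis by (rule that)
qed

section \<open>No antipodal tower in punctured Euclidean space\<close>

text \<open>
  The pairing of an integral cochain with a chain, written through the universal property of free
  abelian groups: chains over a one-point set are integers.
\<close>
definition chain_eval :: "('b \<Rightarrow> int) \<Rightarrow> ('b \<Rightarrow>\<^sub>0 int) \<Rightarrow> int" where
  "chain_eval \<gamma> c = poly_mapping.lookup (frag_extend (\<lambda>f. frag_cmul (\<gamma> f) (frag_of ())) c) ()"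

lemma chain_eval_simps [simp]:
  "chain_eval \<gamma> 0 = 0"
  "chain_eval \<gamma> (frag_of f) = \<gamma> f"
  "chain_eval \<gamma> (frag_cmul k c) = k * chain_eval \<gamma> c"
  "chain_eval \<gamma> (c - d) = chain_eval \<gamma> c - chain_eval \<gamma> d"
  "chain_eval \<gamma> (c + d) = chain_eval \<gamma> c + chain_eval \<gamma> d"
  by (simp_all add: chain_eval_def frag_extend_cmul frag_extend_diff frag_extend_add
      lookup_add lookup_minus)

lemma chain_eval_sum: "chain_eval \<gamma> (sum c I) = (\<Sum>i\<in>I. chain_eval \<gamma> (c i))"
  by (induction I rule: infinite_finite_induct) auto

lemma chain_eval_minus_diff:
  "chain_eval (\<lambda>f. - \<gamma> f - \<delta> f) c = - chain_eval \<gamma> c - chain_eval \<delta> c"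
  using subset_UNIV[of "Poly_Mapping.keys c"] by (induction c rule: frag_induction) auto

lemma even_chain_eval_cong:
  assumes "\<And>f. f \<in> Poly_Mapping.keys c \<Longrightarrow> even (\<gamma> f - \<delta> f)"
  shows "even (chain_eval \<gamma> c - chain_eval \<delta> c)"
proof -
  have "Poly_Mapping.keys c \<subseteq> {f. even (\<gamma> f - \<delta> f)}" using assms by auto
  then show ?thesis by (induction c rule: frag_induction) auto
qed

lemma chain_eval_boundary:
  "even (chain_eval \<gamma> (chain_boundary (Suc k) c)
     - chain_eval (\<lambda>f. \<Sum>i\<le>Suc k. \<gamma> (singular_face (Suc k) i f)) c)"
  using subset_UNIV[of "Poly_Mapping.keys c"]
proof (induction c rule: frag_induction)
  case (one f)
  have "even ((\<Sum>i\<le>Suc k. (-1)^i * \<gamma> (singular_face (Suc k) i f))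
     - (\<Sum>i\<le>Suc k. \<gamma> (singular_face (Suc k) i f)))"
    unfolding sum_subtractf[symmetric] by (rule dvd_sum) auto
  then show ?case by (simp add: chain_boundary_of chain_eval_sum del: sum.atMost_Suc)
qed (auto simp: chain_boundary_diff simp del: sum.atMost_Suc)

lemma chain_eval_chain_map:
  "chain_eval \<gamma> (chain_map k g c) = chain_eval (\<lambda>f. \<gamma> (simplex_map k g f)) c"
  using subset_UNIV[of "Poly_Mapping.keys c"]
  by (induction c rule: frag_induction) (auto simp: chain_map_diff)

definition vertex_labels :: "('a \<Rightarrow> nat) \<Rightarrow> nat \<Rightarrow> ((nat \<Rightarrow> real) \<Rightarrow> 'a) \<Rightarrow> nat list" where
  "vertex_labels l k f = map (\<lambda>i. l (f (\<lambda>j. if j = i then 1 else 0))) [0..<Suc k]"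

lemma vertex_labels_face:
  assumes "i \<le> Suc k"
  shows "vertex_labels l k (singular_face (Suc k) i f) = delete_nth i (vertex_labels l (Suc k) f)"
proof -
  have face: "simplical_face i (\<lambda>j'. if j' = j then 1 else 0)
      = (\<lambda>j'. if j' = (if j < i then j else Suc j) then 1 else (0::real))" for j
    by (auto simp: simplical_face_def fun_eq_iff)
  show ?thesis
  proof (rule nth_equalityI)
    show "length (vertex_labels l k (singular_face (Suc k) i f))
        = length (delete_nth i (vertex_labels l (Suc k) f))"
      using assms by (simp add: vertex_labels_def delete_nth_def del: upt_Suc)
    fix j assume "j < length (vertex_labels l k (singular_face (Suc k) i f))"
    then have "j \<le> k" by (simp add: vertex_labels_def)
    then show "vertex_labels l k (singular_face (Suc k) i f) ! j
        = delete_nth i (vertex_labels l (Suc k) f) ! j"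
      using assms
      by (auto simp: vertex_labels_def delete_nth_def singular_face_def face nth_append
          min_def simp del: upt_Suc)
  qed
qed

lemma vertex_labels_simplex_map:
  "vertex_labels l k (simplex_map k g f) = vertex_labels (l \<circ> g) k f"
  by (auto simp: vertex_labels_def simplex_map_def)

text \<open>
  Fan's parity argument. The count of alternating simplices of either sign in \<open>c k\<close> agrees mod 2
  with the count for one sign in \<open>c k\<close> plus or minus its antipode, hence in the boundary of
  \<open>c (Suc k)\<close>, and by \<open>fan_deletions\<close> with the count of both signs in \<open>c (Suc k)\<close>.
\<close>
lemma no_antipodal_tower_labelled:
  fixes l :: "'a \<Rightarrow> nat"
  assumes tower: "antipodal_tower d X a c"
    and bound: "\<And>x. x \<in> topspace X \<Longrightarrow> l x < 2 * d"
    and odd: "\<And>x. x \<in> topspace X \<Longrightarrow> l (a x) = flip (l x)"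
    and small: "\<And>k f x y. k \<le> d \<Longrightarrow> f \<in> Poly_Mapping.keys (c k) \<Longrightarrow> x \<in> standard_simplex k \<Longrightarrow>
      y \<in> standard_simplex k \<Longrightarrow> l (f y) \<noteq> flip (l (f x))"
  shows False
proof -
  define \<gamma> where "\<gamma> s k f = (of_bool (fan s (vertex_labels l k f)) :: int)" for s k f
  define N where "N k = chain_eval (\<gamma> True k) (c k) + chain_eval (\<gamma> False k) (c k)" for k
  have chain: "singular_chain k X (c k)" if "k \<le> d" for k
    using tower that by (auto simp: antipodal_tower_def)
  have range: "f x \<in> topspace X" if "k \<le> d" "f \<in> Poly_Mapping.keys (c k)" "x \<in> standard_simplex k"
    for k f x
  proof -
    have "singular_simplex k X f"
      using chain[OF that(1)] that(2) unfolding singular_chain_def by blast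
    then show ?thesis
      using that(3) by (auto simp: singular_simplex_def continuous_map_def)
  qed
  have nc: "no_complementary (vertex_labels l k f)" if "k \<le> d" "f \<in> Poly_Mapping.keys (c k)" for k f
    unfolding no_complementary_def
  proof (intro ballI notI)
    fix x assume "x \<in> set (vertex_labels l k f)" "flip x \<in> set (vertex_labels l k f)"
    moreover have "set (vertex_labels l k f) = (\<lambda>i. l (f (\<lambda>j. if j = i then 1 else 0))) ` {..k}"
      by (simp add: vertex_labels_def atLeast0LessThan lessThan_Suc_atMost del: upt_Suc)
    ultimately obtain i j where "i \<le> k" "x = l (f (\<lambda>j. if j = i then 1 else 0))"
      and "j \<le> k" "flip x = l (f (\<lambda>i. if i = j then 1 else 0))"
      by blast
    then show False using small[OF that] by (metis basis_in_standard_simplex)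
  qed
  have "odd (N k)" if "k \<le> d" for k
    using that
  proof (induction k)
    case 0
    obtain f where f: "c 0 = frag_of f" using tower by (auto simp: antipodal_tower_def)
    show ?case by (simp add: N_def f \<gamma>_def fan_def vertex_labels_def)
  next
    case (Suc k)
    have k: "k \<le> d" and bd: "chain_boundary (Suc k) (c (Suc k))
          = c k + frag_cmul ((-1) ^ Suc k) (chain_map k a (c k))"
      using Suc.prems tower by (auto simp: antipodal_tower_def)
    have *: "chain_eval (\<gamma> True k) (chain_map k a (c k))
       = chain_eval (\<lambda>f. \<gamma> True k (simplex_map k a f)) (c k)"
      by (rule chain_eval_chain_map)
    have "even (chain_eval (\<lambda>f. \<gamma> True k (simplex_map k a f)) (c k) - chain_eval (\<gamma> False k) (c k))"
    proof (rule even_chain_eval_cong)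
      fix f assume f: "f \<in> Poly_Mapping.keys (c k)"
      have "vertex_labels l k (simplex_map k a f) = map flip (vertex_labels l k f)"
        unfolding vertex_labels_simplex_map
        using odd range[OF k f] by (auto simp: vertex_labels_def simp del: upt_Suc)
      then show "even (\<gamma> True k (simplex_map k a f) - \<gamma> False k f)"
        using fan_map_flip[OF nc[OF k f], of True] by (simp add: \<gamma>_def)
    qed
    then have 1: "odd (chain_eval (\<gamma> True k) (chain_boundary (Suc k) (c (Suc k))))"
      using Suc.IH[OF k] unfolding bd N_def by (auto simp: *)
    have "even (chain_eval (\<lambda>f. \<Sum>i\<le>Suc k. \<gamma> True k (singular_face (Suc k) i f)) (c (Suc k))
       - chain_eval (\<lambda>f. - \<gamma> True (Suc k) f - \<gamma> False (Suc k) f) (c (Suc k)))"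
    proof (rule even_chain_eval_cong)
      fix f
      have "{..Suc k} = {..<length (vertex_labels l (Suc k) f)}"
        by (auto simp: vertex_labels_def)
      moreover have "(\<Sum>i\<le>Suc k. \<gamma> True k (singular_face (Suc k) i f))
        = (\<Sum>i\<le>Suc k. of_bool (fan True (delete_nth i (vertex_labels l (Suc k) f))))"
        unfolding \<gamma>_def by (intro sum.cong refl) (simp add: vertex_labels_face)
      ultimately show "even ((\<Sum>i\<le>Suc k. \<gamma> True k (singular_face (Suc k) i f))
          - (- \<gamma> True (Suc k) f - \<gamma> False (Suc k) f))"
        using fan_deletions[of True "vertex_labels l (Suc k) f"] by (simp add: \<gamma>_def algebra_simps)
    qed
    moreover have "chain_eval (\<lambda>f. - \<gamma> True (Suc k) f - \<gamma> False (Suc k) f) (c (Suc k)) = - N (Suc k)"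
      by (simp add: N_def chain_eval_minus_diff)
    ultimately show ?case
      using 1 chain_eval_boundary[of "\<gamma> True k" k "c (Suc k)"] by presburger
  qed
  then have "odd (N d)" by simp
  moreover have "even (chain_eval (\<gamma> s d) (c d) - chain_eval (\<lambda>f. 0) (c d))" for s
  proof (rule even_chain_eval_cong)
    fix f assume f: "f \<in> Poly_Mapping.keys (c d)"
    have "\<not> fan s (vertex_labels l d f)"
    proof
      assume "fan s (vertex_labels l d f)"
      moreover have "\<forall>x\<in>set (vertex_labels l d f). x < 2 * d"
        using bound range[OF order_refl f] by (auto simp: vertex_labels_def simp del: upt_Suc)
      ultimately show False
        using fan_length[OF nc[OF order_refl f]] by (fastforce simp: vertex_labels_def)
    qed
    then show "even (\<gamma> s d f - 0)" by (simp add: \<gamma>_def)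
  qed
  moreover have "chain_eval (\<lambda>f. 0) (c d) = 0"
    by (simp add: chain_eval_def frag_extend_def)
  ultimately show False by (simp add: N_def)
qed


lemma continuous_map_uminus_punctured:
  "continuous_map (subtopology (Euclidean_space d) (- {0})) (subtopology (Euclidean_space d) (- {0})) uminus"
  unfolding Euclidean_space_def subtopology_subtopology continuous_map_in_subtopology
    continuous_map_componentwise_UNIV
  by (auto intro!: continuous_map_minus continuous_map_from_subtopology continuous_map_product_projection)

definition pivot :: "nat \<Rightarrow> (nat \<Rightarrow> real) \<Rightarrow> nat" where
  "pivot d z = (LEAST j. j < d \<and> (\<forall>i<d. \<bar>z i\<bar> \<le> \<bar>z j\<bar>))"

lemma pivot:
  assumes "0 < d"
  shows "pivot d z < d" "i < d \<Longrightarrow> \<bar>z i\<bar> \<le> \<bar>z (pivot d z)\<bar>"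
proof -
  have "Max ((\<lambda>i. \<bar>z i\<bar>) ` {..<d}) \<in> (\<lambda>i. \<bar>z i\<bar>) ` {..<d}"
    using assms by (intro Max_in) auto
  then obtain j where j: "j < d" "Max ((\<lambda>i. \<bar>z i\<bar>) ` {..<d}) = \<bar>z j\<bar>" by auto
  have "\<bar>z i\<bar> \<le> \<bar>z j\<bar>" if "i < d" for i
    unfolding j(2)[symmetric] using that by (intro Max_ge) auto
  then have "\<exists>j. j < d \<and> (\<forall>i<d. \<bar>z i\<bar> \<le> \<bar>z j\<bar>)" using j(1) by blast
  then have "pivot d z < d \<and> (\<forall>i<d. \<bar>z i\<bar> \<le> \<bar>z (pivot d z)\<bar>)"
    unfolding pivot_def by (rule LeastI_ex)
  then show "pivot d z < d" "i < d \<Longrightarrow> \<bar>z i\<bar> \<le> \<bar>z (pivot d z)\<bar>" by auto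
qed

text \<open>
  The label of \<open>z\<close> is the first coordinate at which the sup norm is attained, together with its sign. In
  a sup norm neighbourhood of \<open>z0\<close> of radius half the norm of \<open>z0\<close> no two points have complementary
  labels: their values at the common coordinate would exceed half that norm with opposite signs,
  while both lie within half that norm of the same number.
\<close>
lemma no_antipodal_tower_punctured_space:
  "\<not> antipodal_tower d (subtopology (Euclidean_space d) (- {0})) uminus c"
proof
  let ?Z = "subtopology (Euclidean_space d) (- {0})"
  assume tower: "antipodal_tower d ?Z uminus c"
  have topspace: "z \<in> topspace ?Z \<longleftrightarrow> (\<forall>i\<ge>d. z i = 0) \<and> z \<noteq> 0" for z
    by (auto simp: topspace_Euclidean_space)
  have "\<exists>z. z \<in> topspace ?Z"
  proof -
    obtain f where "singular_simplex 0 ?Z f"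
      using tower unfolding antipodal_tower_def by (metis singular_chain_of le0)
    then show ?thesis
      using singular_simplex_empty[of ?Z 0 f] unfolding ex_in_conv by metis
  qed
  then have d: "0 < d" unfolding topspace by (cases d) (auto simp: fun_eq_iff)
  define r where "r z = \<bar>z (pivot d z)\<bar>" for z :: "nat \<Rightarrow> real"
  have r: "\<bar>z i\<bar> \<le> r z" if "i < d" for z i using pivot(2)[OF d that] by (simp add: r_def)
  have r_pos: "0 < r z" if "z \<in> topspace ?Z" for z
  proof -
    have "z \<noteq> 0" and outside: "\<forall>i\<ge>d. z i = 0" using that unfolding topspace by blast+
    then obtain i where i: "z i \<noteq> 0" by (auto simp: fun_eq_iff)
    then have "i < d" using outside by (meson not_le)
    then show ?thesis using r[of i z] i by linarith
  qed
  define l where "l z = (if z (pivot d z) > 0 then 2 * pivot d z else Suc (2 * pivot d z))"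
    for z :: "nat \<Rightarrow> real"
  define V where "V z0 = (\<Inter>j\<in>{..<d}. {z \<in> topspace ?Z. z j \<in> {z0 j - r z0 / 2<..<z0 j + r z0 / 2}})"
    for z0
  have "openin ?Z (V z0)" for z0
    unfolding V_def
  proof (rule openin_INT2)
    show "openin ?Z {z \<in> topspace ?Z. z j \<in> {z0 j - r z0 / 2<..<z0 j + r z0 / 2}}" for j
    proof (rule openin_continuous_map_preimage)
      show "continuous_map ?Z euclideanreal (\<lambda>z. z j)"
        unfolding Euclidean_space_def
        by (intro continuous_map_from_subtopology continuous_map_product_projection) auto
    qed auto
  qed (use d in auto)
  moreover have "z \<in> V z" if "z \<in> topspace ?Z" for z
    using r_pos[OF that] that by (auto simp: V_def)
  ultimately have cover: "U \<in> V ` topspace ?Z \<Longrightarrow> openin ?Z U"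
      "topspace ?Z \<subseteq> \<Union> (V ` topspace ?Z)" for U
    by auto
  obtain e where e: "antipodal_tower d ?Z uminus e"
    and small: "\<And>k f. k \<le> d \<Longrightarrow> f \<in> Poly_Mapping.keys (e k)
      \<Longrightarrow> \<exists>U\<in>V ` topspace ?Z. f ` standard_simplex k \<subseteq> U"
    using antipodal_tower_small[OF tower continuous_map_uminus_punctured cover] by auto
  show False
  proof (rule no_antipodal_tower_labelled[OF e, of l])
    show "l z < 2 * d" for z using pivot(1)[OF d, of z] by (auto simp: l_def)
    show "l (- z) = flip (l z)" if "z \<in> topspace ?Z" for z
    proof -
      have "pivot d (- z) = pivot d z" by (simp add: pivot_def)
      then show ?thesis using r_pos[OF that] by (auto simp: l_def flip_def r_def)
    qed
    fix k f x y
    assume k: "k \<le> d" and f: "f \<in> Poly_Mapping.keys (e k)"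
      and x: "x \<in> standard_simplex k" and y: "y \<in> standard_simplex k"
    obtain z0 where z0: "z0 \<in> topspace ?Z" "f ` standard_simplex k \<subseteq> V z0"
      using small[OF k f] by auto
    have near: "\<bar>z j - z0 j\<bar> < r z0 / 2" if "z \<in> V z0" "j < d" for z j
    proof -
      have "z j \<in> {z0 j - r z0 / 2<..<z0 j + r z0 / 2}" using that by (simp add: V_def)
      then show ?thesis unfolding greaterThanLessThan_iff by linarith
    qed
    have large: "r z0 / 2 < \<bar>z (pivot d z)\<bar>" if "z \<in> V z0" for z
    proof -
      have "\<bar>z (pivot d z0)\<bar> \<le> \<bar>z (pivot d z)\<bar>"
        using pivot[OF d] by blast
      moreover have "\<bar>z (pivot d z0) - z0 (pivot d z0)\<bar> < r z0 / 2"
        using near[OF that pivot(1)[OF d]] .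
      moreover have "r z0 = \<bar>z0 (pivot d z0)\<bar>" by (simp add: r_def)
      ultimately show ?thesis by linarith
    qed
    have no_flip: "l z' \<noteq> flip (l z)" if "z \<in> V z0" "z' \<in> V z0" for z z'
    proof
      assume eq: "l z' = flip (l z)"
      then have "l z' div 2 = l z div 2" by simp
      then have p: "pivot d z' = pivot d z" by (auto simp: l_def split: if_splits)
      define j where "j = pivot d z"
      have "z j > 0 \<longleftrightarrow> even (l z)" "z' j > 0 \<longleftrightarrow> even (l z')"
        using p by (auto simp: l_def j_def)
      then have "z j > 0 \<longleftrightarrow> \<not> z' j > 0" using eq by simp
      moreover have "\<bar>z j - z0 j\<bar> < r z0 / 2" "\<bar>z' j - z0 j\<bar> < r z0 / 2"
        using near that pivot(1)[OF d] by (auto simp: j_def)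
      moreover have "r z0 / 2 < \<bar>z j\<bar>" "r z0 / 2 < \<bar>z' j\<bar>"
        using large[OF that(1)] large[OF that(2)] p by (auto simp: j_def)
      ultimately show False by linarith
    qed
    show "l (f y) \<noteq> flip (l (f x))" using no_flip z0(2) x y by blast
  qed
qed

section \<open>Extending maps over simplices in connected spaces\<close>

lemma continuous_map_Min:
  fixes p :: nat
  assumes "\<And>i. i \<le> p \<Longrightarrow> continuous_map X euclideanreal (\<lambda>x. f x i)"
  shows "continuous_map X euclideanreal (\<lambda>x. Min (f x ` {..p}))"
  using assms
proof (induction p)
  case (Suc p)
  have "Min (f x ` {..Suc p}) = min (f x (Suc p)) (Min (f x ` {..p}))" for x
    by (simp add: atMost_Suc)
  moreover have "continuous_map X euclideanreal (\<lambda>x. min (f x (Suc p)) (Min (f x ` {..p})))"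
    using Suc by (intro continuous_map_real_min) auto
  ultimately show ?case by simp
qed simp

definition simplex_boundary :: "nat \<Rightarrow> (nat \<Rightarrow> real) set" where
  "simplex_boundary p = {x \<in> standard_simplex p. \<exists>k\<le>p. x k = 0}"

text \<open>
  It suffices to be able to move maps between the two shapes: \<open>s\<close> need not be a
  homeomorphism. With \<open>b\<close> the barycenter, drop the last coordinate and put \<open>s x = (x - b) / (|x - b| + min x)\<close>.
  The minimal barycentric coordinate vanishes exactly on the boundary, which makes \<open>s x\<close> a unit vector there,
  and it is positive at \<open>b\<close>, which makes the denominator positive everywhere.
  The map \<open>t\<close> sends a unit vector to the point where the ray from \<open>b\<close> in its direction
  leaves the simplex.
\<close>
lemma simplex_ball_maps:
  obtains s t where
    "continuous_map (subtopology (powertop_real UNIV) (standard_simplex (Suc q))) (nball (Suc q)) s"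
    "continuous_map (nsphere q) (subtopology (powertop_real UNIV) (simplex_boundary (Suc q))) t"
    "\<And>x. x \<in> simplex_boundary (Suc q) \<Longrightarrow> s x \<in> topspace (nsphere q) \<and> t (s x) = x"
proof -
  define c where "c = 1 / real (q + 2)"
  have c: "0 < c" and c_eq: "1 - real (Suc q) * c = c"
    by (auto simp: c_def field_simps)
  define N where "N x = sqrt (\<Sum>i\<le>q. (x i - c)\<^sup>2)" for x :: "nat \<Rightarrow> real"
  define m where "m x = Min (x ` {..Suc q})" for x :: "nat \<Rightarrow> real"
  define s where "s x = (\<lambda>i. if i \<le> q then (x i - c) / (N x + m x) else 0)" for x
  \<comment> \<open>the last coordinate is restored from the condition that the coordinates sum to zero\<close>
  define Y where "Y u i = (if i \<le> q then u i else - (\<Sum>i\<le>q. u i))" for u :: "nat \<Rightarrow> real" and i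
  define t where "t u = (\<lambda>i. if i \<le> Suc q then c - c * Y u i / m (Y u) else 0)" for u
  have m_le: "m x \<le> x i" if "i \<le> Suc q" for x i
    unfolding m_def using that by (intro Min_le) auto
  have m_in: "\<exists>i\<le>Suc q. m x = x i" for x
  proof -
    have "m x \<in> x ` {..Suc q}" unfolding m_def by (rule Min_in) auto
    then show ?thesis by auto
  qed
  have N_nonneg: "0 \<le> N x" and N_sq: "(N x)\<^sup>2 = (\<Sum>i\<le>q. (x i - c)\<^sup>2)" for x
    by (auto simp: N_def sum_nonneg)
  have barycenter: "x i = c" if "x \<in> standard_simplex (Suc q)" "N x = 0" "i \<le> Suc q" for x i
  proof -
    have "\<forall>i\<le>q. x i = c"
      using that(2) by (simp add: N_def sum_nonneg_eq_0_iff)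
    moreover have "(\<Sum>i\<le>q. x i) + x (Suc q) = 1"
      using that(1) by (simp add: standard_simplex_def)
    ultimately have "x (Suc q) = c" using c_eq by simp
    then show ?thesis using \<open>\<forall>i\<le>q. x i = c\<close> that(3) le_Suc_eq by auto
  qed
  have denominator: "0 < N x + m x" if "x \<in> standard_simplex (Suc q)" for x
  proof -
    obtain i where i: "i \<le> Suc q" "m x = x i" using m_in by blast
    have "0 \<le> m x" using that i by (auto simp: standard_simplex_def)
    moreover have "m x = c" if "N x = 0" using barycenter[OF \<open>x \<in> _\<close> that i(1)] i(2) by simp
    ultimately show ?thesis using N_nonneg[of x] c by (cases "N x = 0") auto
  qed
  have proj: "continuous_map (subtopology (powertop_real UNIV) S) euclideanreal (\<lambda>x. x i)" for S i
    by (intro continuous_map_from_subtopology continuous_map_product_projection) auto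
  have 1: "continuous_map (subtopology (powertop_real UNIV) (standard_simplex (Suc q))) (nball (Suc q)) s"
    unfolding nball_def Euclidean_space_def subtopology_subtopology continuous_map_in_subtopology
      continuous_map_componentwise_UNIV
  proof (intro conjI allI funcsetI)
    show "continuous_map (subtopology (powertop_real UNIV) (standard_simplex (Suc q))) euclideanreal (\<lambda>x. s x i)" for i
    proof (cases "i \<le> q")
      case True
      have "continuous_map (subtopology (powertop_real UNIV) (standard_simplex (Suc q))) euclideanreal
          (\<lambda>x. (x i - c) / (N x + m x))"
        unfolding m_def N_def
      proof (intro continuous_map_real_divide continuous_map_add continuous_map_Min continuous_map_diff
          proj continuous_map_sum continuous_map_real_pow continuous_map_sqrt continuous_map_canonical_const)
        fix x assume "x \<in> topspace (subtopology (powertop_real UNIV) (standard_simplex (Suc q)))"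
        then show "sqrt (\<Sum>i\<le>q. (x i - c)\<^sup>2) + Min (x ` {..Suc q}) \<noteq> 0"
          using denominator[of x] by (auto simp: N_def m_def)
      qed auto
      then show ?thesis using True by (simp add: s_def)
    qed (simp add: s_def)
    fix x assume "x \<in> topspace (subtopology (powertop_real UNIV) (standard_simplex (Suc q)))"
    then have x: "x \<in> standard_simplex (Suc q)" by simp
    have "0 \<le> m x" using m_in[of x] x by (auto simp: standard_simplex_def)
    then have "(N x)\<^sup>2 \<le> (N x + m x)\<^sup>2" using N_nonneg by (intro power_mono) auto
    then have "(\<Sum>i<Suc q. (s x i)\<^sup>2) \<le> 1"
      using denominator[OF x]
      by (simp add: s_def lessThan_Suc_atMost power_divide N_sq flip: sum_divide_distrib)
    then show "s x \<in> {x. \<forall>i\<ge>Suc q. x i = 0} \<inter> {x. (\<Sum>i<Suc q. (x i)\<^sup>2) \<le> 1}"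
      by (auto simp: s_def)
  qed
  have Y_sum: "(\<Sum>i\<le>Suc q. Y u i) = 0" for u by (simp add: Y_def)
  have m_neg: "m (Y u) < 0" if "u \<in> topspace (nsphere q)" for u
  proof (rule ccontr)
    assume "\<not> m (Y u) < 0"
    then have "\<forall>i\<le>Suc q. 0 \<le> Y u i" using m_le[of _ "Y u"] by force
    then have "\<forall>i\<le>Suc q. Y u i = 0"
      using Y_sum[of u] by (subst (asm) sum_nonneg_eq_0_iff) auto
    then have "\<forall>i\<le>q. u i = 0" by (auto simp: Y_def split: if_splits)
    then show False using that by (simp add: nsphere)
  qed
  have 2: "continuous_map (nsphere q) (subtopology (powertop_real UNIV) (simplex_boundary (Suc q))) t"
    unfolding continuous_map_in_subtopology continuous_map_componentwise_UNIV
  proof (intro conjI allI funcsetI)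
    have cont_Y: "continuous_map (nsphere q) euclideanreal (\<lambda>u. Y u i)" for i
      unfolding Y_def
      by (cases "i \<le> q")
        (auto intro!: continuous_map_minus continuous_map_sum continuous_map_nsphere_projection)
    show "continuous_map (nsphere q) euclideanreal (\<lambda>u. t u i)" for i
    proof (cases "i \<le> Suc q")
      case True
      have "continuous_map (nsphere q) euclideanreal (\<lambda>u. c - c * Y u i / m (Y u))"
        unfolding m_def
        by (intro continuous_map_diff continuous_map_real_divide continuous_map_real_mult
            continuous_map_Min cont_Y continuous_map_canonical_const)
          (use m_neg in \<open>force simp: m_def\<close>)+
      then show ?thesis using True by (simp add: t_def)
    qed (simp add: t_def)
    fix u assume u: "u \<in> topspace (nsphere q)"
    have nonneg: "0 \<le> t u i" for i
    proof (cases "i \<le> Suc q")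
      case True
      have "Y u i / m (Y u) \<le> 1"
        using m_neg[OF u] m_le[OF True, of "Y u"] by (simp add: divide_le_eq)
      then have "c * (Y u i / m (Y u)) \<le> c * 1" using c by (intro mult_left_mono) auto
      then show ?thesis using True by (simp add: t_def)
    qed (simp add: t_def)
    have "(\<Sum>i\<le>Suc q. t u i) = (\<Sum>i\<le>Suc q. c) - c * (\<Sum>i\<le>Suc q. Y u i) / m (Y u)"
      by (simp only: sum_subtractf sum_distrib_left sum_divide_distrib t_def)
        (simp add: sum_subtractf sum_distrib_left sum_divide_distrib diff_divide_distrib)
    also have "\<dots> = 1" unfolding Y_sum using c_eq by (simp add: algebra_simps)
    finally have sum: "(\<Sum>i\<le>Suc q. t u i) = 1" .
    have "t u i \<le> 1" for i
    proof (cases "i \<le> Suc q")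
      case True
      then have "t u i \<le> (\<Sum>i\<le>Suc q. t u i)" using nonneg by (intro member_le_sum) auto
      then show ?thesis using sum by simp
    qed (simp add: t_def)
    moreover have "\<exists>k\<le>Suc q. t u k = 0"
    proof -
      obtain k where "k \<le> Suc q" "m (Y u) = Y u k" using m_in by blast
      then show ?thesis using m_neg[OF u] by (intro exI[of _ k]) (simp add: t_def)
    qed
    ultimately show "t u \<in> simplex_boundary (Suc q)"
      using nonneg sum by (auto simp: simplex_boundary_def standard_simplex_def t_def)
  qed
  have 3: "s x \<in> topspace (nsphere q) \<and> t (s x) = x" if xb: "x \<in> simplex_boundary (Suc q)" for x
  proof -
    have x: "x \<in> standard_simplex (Suc q)" using that by (simp add: simplex_boundary_def)
    obtain k where k: "k \<le> Suc q" "x k = 0" using xb by (auto simp: simplex_boundary_def)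
    have m0: "m x = 0"
      using m_le[OF k(1), of x] k m_in[of x] x by (auto simp: standard_simplex_def intro: antisym)
    have N_pos: "0 < N x" using denominator[OF x] m0 by simp
    have u: "s x i = (x i - c) / N x" if "i \<le> q" for i using that m0 by (simp add: s_def)
    have "(\<Sum>i\<le>q. (s x i)\<^sup>2) = (N x)\<^sup>2 / (N x)\<^sup>2"
      by (simp add: u power_divide N_sq flip: sum_divide_distrib)
    then have sphere: "s x \<in> topspace (nsphere q)"
      using N_pos by (auto simp: nsphere s_def)
    have sum: "(\<Sum>i\<le>q. x i) + x (Suc q) = 1" using x by (simp add: standard_simplex_def)
    have Y: "Y (s x) i = (x i - c) / N x" if "i \<le> Suc q" for i
    proof (cases "i \<le> q")
      case False
      then have i: "i = Suc q" using that by simp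
      have "(\<Sum>i\<le>q. s x i) = ((\<Sum>i\<le>q. x i) - real (Suc q) * c) / N x"
        by (simp add: u sum_subtractf flip: sum_divide_distrib)
      also have "\<dots> = - ((x (Suc q) - c) / N x)"
      proof -
        have "(\<Sum>i\<le>q. x i) - real (Suc q) * c = - (x (Suc q) - c)"
          using sum c_eq by linarith
        then show ?thesis by (simp only: minus_divide_left)
      qed
      finally show ?thesis by (simp add: Y_def i)
    qed (simp add: Y_def u)
    have "m (Y (s x)) = - c / N x"
      unfolding m_def
    proof (rule Min_eqI)
      show "- c / N x \<in> Y (s x) ` {..Suc q}"
        using k Y[OF k(1)] by (intro image_eqI[of _ _ k]) auto
      fix y assume "y \<in> Y (s x) ` {..Suc q}"
      then obtain i where "i \<le> Suc q" "y = (x i - c) / N x" using Y by auto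
      then show "- c / N x \<le> y"
        using N_pos x divide_right_mono[of "- c" "x i - c" "N x"] by (auto simp: standard_simplex_def)
    qed simp
    then have "t (s x) i = x i" for i
      using N_pos c x by (cases "i \<le> Suc q") (auto simp: t_def Y standard_simplex_def field_simps)
    then show ?thesis using sphere by auto
  qed
  show ?thesis using that[OF 1 2 3] .
qed

text \<open>
  The matching conditions on double faces are exactly what is needed to paste the maps \<open>h k\<close> to a map on the
  boundary. Transported to the sphere it extends over the ball, and hence over the simplex.
\<close>
lemma simplex_extension:
  assumes conn: "n_connected n X" and p: "p \<le> Suc n"
    and h: "\<And>k. 0 < p \<Longrightarrow> k \<le> p \<Longrightarrow> singular_simplex (p - 1) X (h k)"
    and match: "\<And>j k. 2 \<le> p \<Longrightarrow> j < k \<Longrightarrow> k \<le> p \<Longrightarrow>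
      singular_face (p - 1) j (h k) = singular_face (p - 1) (k - 1) (h j)"
  obtains f where "singular_simplex p X f" "\<And>k. 0 < p \<Longrightarrow> k \<le> p \<Longrightarrow> singular_face p k f = h k"
proof (cases p)
  case 0
  obtain a where "a \<in> topspace X" using conn unfolding n_connected_def by blast
  then have "singular_simplex p X (\<lambda>x\<in>standard_simplex p. a)"
    by (simp add: singular_simplex_def)
  then show ?thesis using that 0 by blast
next
  case (Suc q)
  let ?P = "powertop_real UNIV"
  define del where "del k x = (\<lambda>i. if i < k then x i else x (Suc i))" for k and x :: "nat \<Rightarrow> real"
  define T where "T k = {x \<in> simplex_boundary p. x k = 0}" for k
  have del_face: "del k (simplical_face k z) = z" for k z
    by (auto simp: del_def simplical_face_def fun_eq_iff)
  \<comment> \<open>\<open>del k\<close> is the inverse of the \<open>k\<close>-th face inclusion\<close>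
  have face_del: "simplical_face k (del k x) = x" if "x k = 0" for k x
    using that by (auto simp: del_def simplical_face_def fun_eq_iff)
  have del_simplex: "del k x \<in> standard_simplex r"
    if "x \<in> standard_simplex (Suc r)" "x k = 0" "k \<le> Suc r" for k x r
  proof -
    have "{..Suc r} = insert k ({..<k} \<union> Suc ` {k..r})"
      using that(3) by (auto simp: image_iff not_less)
    then have "(\<Sum>i\<le>Suc r. x i) = (\<Sum>i\<in>insert k ({..<k} \<union> Suc ` {k..r}). x i)" by presburger
    also have "\<dots> = (\<Sum>i\<in>{..<k} \<union> Suc ` {k..r}. x i)"
      using that(2) by (simp add: sum.insert_if del: image_Suc_atLeastAtMost)
    also have "\<dots> = (\<Sum>i<k. x i) + (\<Sum>i\<in>Suc ` {k..r}. x i)"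
      by (intro sum.union_disjoint) auto
    also have "(\<Sum>i\<in>Suc ` {k..r}. x i) = (\<Sum>i=k..r. x (Suc i))"
      by (simp add: sum.reindex del: image_Suc_atLeastAtMost)
    also have "(\<Sum>i<k. x i) + (\<Sum>i=k..r. x (Suc i)) = (\<Sum>i<k. del k x i) + (\<Sum>i=k..r. del k x i)"
      by (simp add: del_def)
    also have "\<dots> = (\<Sum>i\<in>{..<k} \<union> {k..r}. del k x i)"
      by (subst sum.union_disjoint) auto
    also have "{..<k} \<union> {k..r} = {..r} \<union> {..<k}" by auto
    also have "(\<Sum>i\<in>{..r} \<union> {..<k}. del k x i) = (\<Sum>i\<le>r. del k x i)"
      using that by (intro sum.mono_neutral_right) (auto simp: del_def standard_simplex_def)
    finally show ?thesis
      using that by (auto simp: standard_simplex_def del_def)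
  qed
  obtain g where g: "continuous_map (subtopology ?P (simplex_boundary p)) X g"
    and g_eq: "\<And>x k. k \<in> {..p} \<Longrightarrow> x \<in> topspace (subtopology ?P (simplex_boundary p)) \<inter> T k
      \<Longrightarrow> g x = (h k \<circ> del k) x"
  proof (rule pasting_lemma_exists_closed[of "{..p}" "subtopology ?P (simplex_boundary p)" T X "\<lambda>k. h k \<circ> del k"])
    show "topspace (subtopology ?P (simplex_boundary p)) \<subseteq> \<Union> (T ` {..p})"
      by (auto simp: T_def simplex_boundary_def)
    show "closedin (subtopology ?P (simplex_boundary p)) (T k)" for k
    proof -
      have "closedin (subtopology ?P (simplex_boundary p))
          {x \<in> topspace (subtopology ?P (simplex_boundary p)). x k \<in> {0}}"
        by (rule closedin_continuous_map_preimage[where Y = euclideanreal])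
          (auto intro: continuous_map_from_subtopology continuous_map_product_projection)
      then show ?thesis by (simp add: T_def)
    qed
    show "continuous_map (subtopology (subtopology ?P (simplex_boundary p)) (T k)) X (h k \<circ> del k)"
      if "k \<in> {..p}" for k
    proof (rule continuous_map_compose)
      show "continuous_map (subtopology ?P (standard_simplex q)) X (h k)"
        using h[of k] that Suc by (auto simp: singular_simplex_def)
      show "continuous_map (subtopology (subtopology ?P (simplex_boundary p)) (T k))
          (subtopology ?P (standard_simplex q)) (del k)"
        unfolding subtopology_subtopology continuous_map_in_subtopology continuous_map_componentwise_UNIV
      proof (intro conjI allI funcsetI)
        show "continuous_map (subtopology ?P (simplex_boundary p \<inter> T k)) euclideanreal (\<lambda>x. del k x i)" for i
          unfolding del_def
          by (cases "i < k") (auto intro: continuous_map_from_subtopology continuous_map_product_projection)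
        fix x assume "x \<in> topspace (subtopology ?P (simplex_boundary p \<inter> T k))"
        then show "del k x \<in> standard_simplex q"
          using that Suc by (auto intro!: del_simplex simp: T_def simplex_boundary_def)
      qed
    qed
    have agree: "(h k \<circ> del k) x = (h j \<circ> del j) x"
      if "j < k" "k \<le> p" "x \<in> simplex_boundary p" "x k = 0" "x j = 0" for j k x
    proof -
      have x: "x \<in> standard_simplex (Suc q)" using that Suc by (simp add: simplex_boundary_def)
      have q: "q \<noteq> 0"
      proof
        assume "q = 0"
        then have "j = 0" "k = 1" using that Suc by auto
        then show False using x that \<open>q = 0\<close> by (simp add: standard_simplex_def)
      qed
      then obtain r where r: "q = Suc r" by (cases q) auto
      define z where "z = del j (del k x)"
      have z': "z = del (k - 1) (del j x)"
        using that(1) by (auto simp: z_def del_def fun_eq_iff)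
      have dk: "del k x \<in> standard_simplex q" using del_simplex[OF x] that Suc by auto
      have dj: "del k x j = 0" "del j x (k - 1) = 0" using that by (auto simp: del_def)
      have z: "z \<in> standard_simplex (q - 1)"
        using del_simplex[of "del k x" r j] dk dj that r Suc by (auto simp: z_def)
      have "h k (del k x) = singular_face q j (h k) z"
        using z face_del[of "del k x" j] dj by (simp add: singular_face_def z_def)
      also have "\<dots> = singular_face q (k - 1) (h j) z"
        using match[of j k] that r Suc by simp
      also have "\<dots> = h j (del j x)"
        using z face_del[of "del j x" "k - 1"] dj by (simp add: singular_face_def z')
      finally show ?thesis by simp
    qed
    show "(h i \<circ> del i) x = (h j \<circ> del j) x"
      if "i \<in> {..p}" "j \<in> {..p}" "x \<in> topspace (subtopology ?P (simplex_boundary p)) \<inter> T i \<inter> T j" for i j x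
      using that agree[of i j x] agree[of j i x] by (cases i j rule: linorder_cases) (auto simp: T_def)
  qed (use that in auto)
  obtain s t where s: "continuous_map (subtopology ?P (standard_simplex p)) (nball p) s"
    and t: "continuous_map (nsphere q) (subtopology ?P (simplex_boundary p)) t"
    and st: "\<And>x. x \<in> simplex_boundary p \<Longrightarrow> s x \<in> topspace (nsphere q) \<and> t (s x) = x"
    using simplex_ball_maps[of q] Suc by metis
  have "continuous_map (nsphere q) X (g \<circ> t)"
    using t g by (rule continuous_map_compose)
  then obtain G where G: "continuous_map (nball (Suc q)) X G"
    and G_eq: "\<forall>x\<in>topspace (nsphere q). G x = (g \<circ> t) x"
    using conn p Suc unfolding n_connected_def by (metis Suc_le_mono)
  define f where "f = restrict (G \<circ> s) (standard_simplex p)"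
  show ?thesis
  proof (rule that)
    have "continuous_map (subtopology ?P (standard_simplex p)) X (G \<circ> s)"
      using s G Suc by (auto intro: continuous_map_compose)
    then show "singular_simplex p X f"
      by (simp add: singular_simplex_def f_def)
    fix k assume k: "k \<le> p"
    have hk: "h k \<in> extensional (standard_simplex q)"
      using h[of k] k Suc by (simp add: singular_simplex_def)
    show "singular_face p k f = h k"
    proof
      fix z
      show "singular_face p k f z = h k z"
      proof (cases "z \<in> standard_simplex q")
        case True
        let ?x = "simplical_face k z"
        have x: "?x \<in> standard_simplex p"
          using simplical_face_in_standard_simplex[of p k z] True k Suc by simp
        have x0: "?x k = 0" by (simp add: simplical_face_def)
        then have xb: "?x \<in> simplex_boundary p" using x k by (auto simp: simplex_boundary_def)
        have "f ?x = g ?x" using x st[OF xb] G_eq by (simp add: f_def)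
        also have "\<dots> = h k (del k ?x)" using g_eq[of k ?x] k xb x0 by (simp add: T_def)
        finally show ?thesis using True Suc by (simp add: singular_face_def del_face)
      next
        case False
        then show ?thesis using hk Suc by (simp add: singular_face_def extensional_def)
      qed
    qed
  qed
qed

section \<open>Equivariant selections from connected carriers\<close>

lemma singular_face_face:
  assumes "2 \<le> p" "j < k" "k \<le> p"
  shows "singular_face (p - 1) j (singular_face p k f)
       = singular_face (p - 1) (k - 1) (singular_face p j f)"
proof
  fix t
  show "singular_face (p - 1) j (singular_face p k f) t
      = singular_face (p - 1) (k - 1) (singular_face p j f) t"
  proof (cases "t \<in> standard_simplex (p - 1 - 1)")
    case True
    have "simplical_face j t \<in> standard_simplex (p - 1)"
      "simplical_face (k - 1) t \<in> standard_simplex (p - 1)"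
      using True assms by (auto intro!: simplical_face_in_standard_simplex)
    moreover have "simplical_face k (simplical_face j t) = simplical_face j (simplical_face (k - 1) t)"
      using assms by (auto simp: simplical_face_def fun_eq_iff)
    ultimately show ?thesis using True by (simp add: singular_face_def)
  qed (simp add: singular_face_def)
qed

lemma image_singular_face:
  assumes "k \<le> Suc p"
  shows "singular_face (Suc p) k f ` standard_simplex p \<subseteq> f ` standard_simplex (Suc p)"
  using assms simplical_face_in_standard_simplex[of "Suc p" k] by (auto simp: singular_face_def)

lemma image_simplex_map:
  "simplex_map p g f ` standard_simplex p = g ` f ` standard_simplex p"
  by (auto simp: simplex_map_def)

lemma singular_face_simplex_map_commute:
  assumes "k \<le> Suc p"
  shows "singular_face (Suc p) k (simplex_map (Suc p) g f) = simplex_map p g (singular_face (Suc p) k f)"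
  using assms simplical_face_in_standard_simplex[of "Suc p" k]
  by (auto simp: singular_face_def simplex_map_def fun_eq_iff)

lemma simplex_map_involution:
  assumes "singular_simplex p X f" "\<And>x. x \<in> topspace X \<Longrightarrow> a (a x) = x"
  shows "simplex_map p a (simplex_map p a f) = f"
  using simplex_map_id_gen[of p X f "a \<circ> a"] assms by (simp add: simplex_map_compose)

text \<open>
  Since the involution is free, a choice can be made on one point of each orbit and transported to the other.
\<close>
lemma equivariant_choice:
  assumes \<alpha>: "\<And>x. x \<in> S \<Longrightarrow> \<alpha> x \<in> S \<and> \<alpha> (\<alpha> x) = x \<and> \<alpha> x \<noteq> x"
    and ex: "\<And>x. x \<in> S \<Longrightarrow> \<exists>y. R x y"
    and R: "\<And>x y. x \<in> S \<Longrightarrow> R x y \<Longrightarrow> R (\<alpha> x) (\<beta> y) \<and> \<beta> (\<beta> y) = y"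
  obtains \<psi> where "\<And>x. x \<in> S \<Longrightarrow> R x (\<psi> x)" "\<And>x. x \<in> S \<Longrightarrow> \<psi> (\<alpha> x) = \<beta> (\<psi> x)"
proof -
  define G where "G x = (SOME y. R x y)" for x
  have G: "R x (G x)" if "x \<in> S" for x unfolding G_def using ex[OF that] by (rule someI_ex)
  define rep where "rep P = (SOME x. x \<in> P)" for P :: "'a set"
  define \<psi> where "\<psi> x = (if rep {x, \<alpha> x} = x then G x else \<beta> (G (\<alpha> x)))" for x
  have rep: "rep {x, \<alpha> x} = x \<or> rep {x, \<alpha> x} = \<alpha> x" for x
    using someI[of "\<lambda>y. y \<in> {x, \<alpha> x}" x] by (auto simp: rep_def)
  show ?thesis
  proof (rule that)
    fix x assume x: "x \<in> S"
    have \<alpha>x: "\<alpha> x \<in> S" "\<alpha> (\<alpha> x) = x" "\<alpha> x \<noteq> x" using \<alpha>[OF x] by auto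
    have "R x (\<beta> (G (\<alpha> x)))" using R[OF \<alpha>x(1) G[OF \<alpha>x(1)]] \<alpha>x(2) by simp
    then show "R x (\<psi> x)" using G[OF x] by (simp add: \<psi>_def)
    have "{\<alpha> x, \<alpha> (\<alpha> x)} = {x, \<alpha> x}" using \<alpha>x(2) by auto
    then show "\<psi> (\<alpha> x) = \<beta> (\<psi> x)"
      using rep[of x] \<alpha>x R[OF \<alpha>x(1) G[OF \<alpha>x(1)]] by (auto simp: \<psi>_def)
  qed
qed

text \<open>
  A singular and equivariant form of the method of acyclic carriers, with homotopical instead of
  homological connectedness. The selection is constructed by induction on the dimension. The values on the
  faces of \<open>\<sigma>\<close> lie in the carrier of \<open>\<sigma>\<close> by monotonicity and match on double faces because
  the previous step was itself compatible with faces.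
\<close>
lemma equivariant_selection:
  fixes X :: "'a topology" and Y :: "'b topology" and C :: "'a set \<Rightarrow> 'b set"
  assumes a: "continuous_map X X a" "\<And>x. x \<in> topspace X \<Longrightarrow> a (a x) = x \<and> a x \<noteq> x"
    and b: "continuous_map Y Y b" "\<And>y. y \<in> topspace Y \<Longrightarrow> b (b y) = y"
    and mono: "\<And>S T. S \<subseteq> T \<Longrightarrow> T \<subseteq> topspace X \<Longrightarrow> C S \<subseteq> C T"
    and equi: "\<And>S. S \<subseteq> topspace X \<Longrightarrow> b ` C S \<subseteq> C (a ` S)"
    and conn: "\<And>S. S \<subseteq> topspace X \<Longrightarrow> S \<noteq> {} \<Longrightarrow> n_connected n (subtopology Y (C S))"
  obtains \<phi> where
    "\<And>p \<sigma>. p \<le> Suc n \<Longrightarrow> singular_simplex p X \<sigma> \<Longrightarrow>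
       singular_simplex p (subtopology Y (C (\<sigma> ` standard_simplex p))) (\<phi> p \<sigma>)"
    "\<And>p \<sigma>. p \<le> Suc n \<Longrightarrow> singular_simplex p X \<sigma> \<Longrightarrow>
       \<phi> p (simplex_map p a \<sigma>) = simplex_map p b (\<phi> p \<sigma>)"
    "\<And>p \<sigma> k. p \<le> n \<Longrightarrow> singular_simplex (Suc p) X \<sigma> \<Longrightarrow> k \<le> Suc p \<Longrightarrow>
       singular_face (Suc p) k (\<phi> (Suc p) \<sigma>) = \<phi> p (singular_face (Suc p) k \<sigma>)"
proof -
  define carried where "carried p \<sigma> \<tau> \<longleftrightarrow>
    singular_simplex p (subtopology Y (C (\<sigma> ` standard_simplex p))) \<tau>" for p \<sigma> \<tau>
  define faces where "faces p \<psi> \<sigma> \<tau> \<longleftrightarrow>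
    (\<forall>k\<le>p. 0 < p \<longrightarrow> singular_face p k \<tau> = \<psi> (singular_face p k \<sigma>))"
    for p and \<psi> :: "((nat \<Rightarrow> real) \<Rightarrow> 'a) \<Rightarrow> (nat \<Rightarrow> real) \<Rightarrow> 'b" and \<sigma> \<tau>
  \<comment> \<open>The last clause keeps from the previous dimension only the fact that the values on faces depend on
    the faces alone; this is what makes the values on double faces match.\<close>
  define P where "P p \<psi> \<longleftrightarrow> (p \<le> Suc n \<longrightarrow>
    (\<forall>\<sigma>. singular_simplex p X \<sigma> \<longrightarrow> carried p \<sigma> (\<psi> \<sigma>) \<and>
       \<psi> (simplex_map p a \<sigma>) = simplex_map p b (\<psi> \<sigma>)) \<and>
    (\<exists>\<psi>0. \<forall>\<sigma>. singular_simplex p X \<sigma> \<longrightarrow> faces p \<psi>0 \<sigma> (\<psi> \<sigma>)))"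
    for p \<psi>
  define Q where "Q p \<psi> \<psi>' \<longleftrightarrow> (Suc p \<le> Suc n \<longrightarrow>
    (\<forall>\<sigma>. singular_simplex (Suc p) X \<sigma> \<longrightarrow> faces (Suc p) \<psi> \<sigma> (\<psi>' \<sigma>)))" for p \<psi> \<psi>'
  have img: "\<sigma> ` standard_simplex p \<subseteq> topspace X" if "singular_simplex p X \<sigma>" for p \<sigma>
    using that by (auto simp: singular_simplex_def continuous_map_def)
  have \<alpha>: "simplex_map p a \<sigma> \<in> singular_simplex_set p X \<and>
      simplex_map p a (simplex_map p a \<sigma>) = \<sigma> \<and> simplex_map p a \<sigma> \<noteq> \<sigma>"
    if "\<sigma> \<in> singular_simplex_set p X" for p \<sigma>
  proof -
    have \<sigma>: "singular_simplex p X \<sigma>" using that by simp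
    obtain v where v: "v \<in> standard_simplex p" using nonempty_standard_simplex by blast
    have "simplex_map p a \<sigma> v \<noteq> \<sigma> v"
      using v img[OF \<sigma>] a(2) by (auto simp: simplex_map_def)
    then show ?thesis
      using simplex_map_involution[OF \<sigma>, of a] a \<sigma> by (auto intro: singular_simplex_simplex_map)
  qed
  have carried_antipode: "carried p (simplex_map p a \<sigma>) (simplex_map p b \<tau>) \<and>
      simplex_map p b (simplex_map p b \<tau>) = \<tau>"
    if "singular_simplex p X \<sigma>" "carried p \<sigma> \<tau>" for p \<sigma> \<tau>
  proof -
    have \<tau>: "singular_simplex p Y \<tau>" "\<tau> ` standard_simplex p \<subseteq> C (\<sigma> ` standard_simplex p)"
      using that(2) by (auto simp: carried_def singular_simplex_subtopology)
    have "b ` \<tau> ` standard_simplex p \<subseteq> b ` C (\<sigma> ` standard_simplex p)" using \<tau>(2) by (rule image_mono)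
    also have "\<dots> \<subseteq> C (a ` \<sigma> ` standard_simplex p)" using equi[OF img[OF that(1)]] .
    finally have "carried p (simplex_map p a \<sigma>) (simplex_map p b \<tau>)"
      using \<tau>(1) b(1) singular_simplex_simplex_map[of p Y \<tau> Y b]
      by (simp add: carried_def singular_simplex_subtopology image_simplex_map)
    then show ?thesis using simplex_map_involution[OF \<tau>(1), of b] b(2) by simp
  qed
  have "\<exists>\<psi>. P 0 \<psi>"
  proof -
    have ex: "\<exists>\<tau>. carried 0 \<sigma> \<tau>" if "\<sigma> \<in> singular_simplex_set 0 X" for \<sigma>
    proof -
      have "n_connected n (subtopology Y (C (\<sigma> ` standard_simplex 0)))"
        using that img[of 0 \<sigma>] nonempty_standard_simplex by (intro conn) auto
      from simplex_extension[OF this, of 0 undefined]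
      show ?thesis unfolding carried_def by auto
    qed
    obtain \<psi> where "\<And>\<sigma>. \<sigma> \<in> singular_simplex_set 0 X \<Longrightarrow> carried 0 \<sigma> (\<psi> \<sigma>)"
      "\<And>\<sigma>. \<sigma> \<in> singular_simplex_set 0 X \<Longrightarrow> \<psi> (simplex_map 0 a \<sigma>) = simplex_map 0 b (\<psi> \<sigma>)"
      by (rule equivariant_choice[of "singular_simplex_set 0 X" "simplex_map 0 a" "carried 0" "simplex_map 0 b"])
        (use \<alpha> ex carried_antipode in auto)
    then show ?thesis by (auto simp: P_def faces_def)
  qed
  moreover have "\<exists>\<psi>'. P (Suc p) \<psi>' \<and> Q p \<psi> \<psi>'" if P: "P p \<psi>" for p \<psi>
  proof (cases "Suc p \<le> Suc n")
    case False
    then show ?thesis by (auto simp: P_def Q_def)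
  next
    case True
    have \<psi>: "carried p \<sigma> (\<psi> \<sigma>)" "\<psi> (simplex_map p a \<sigma>) = simplex_map p b (\<psi> \<sigma>)"
      if "singular_simplex p X \<sigma>" for \<sigma>
      using P True that by (auto simp: P_def)
    obtain \<psi>0 where \<psi>0: "\<And>\<sigma>. singular_simplex p X \<sigma> \<Longrightarrow> faces p \<psi>0 \<sigma> (\<psi> \<sigma>)"
      using P True by (auto simp: P_def)
    define R where "R \<sigma> \<tau> \<longleftrightarrow> carried (Suc p) \<sigma> \<tau> \<and> faces (Suc p) \<psi> \<sigma> \<tau>" for \<sigma> \<tau>
    have face_simplex: "singular_simplex p X (singular_face (Suc p) k \<sigma>)"
      if "singular_simplex (Suc p) X \<sigma>" "k \<le> Suc p" for \<sigma> k
      using singular_simplex_singular_face[OF that(1), of k] that(2) by simp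
    have ex: "\<exists>\<tau>. R \<sigma> \<tau>" if "\<sigma> \<in> singular_simplex_set (Suc p) X" for \<sigma>
    proof -
      have \<sigma>: "singular_simplex (Suc p) X \<sigma>" using that by simp
      let ?Y = "subtopology Y (C (\<sigma> ` standard_simplex (Suc p)))"
      have "n_connected n ?Y"
        using img[OF \<sigma>] nonempty_standard_simplex by (intro conn) auto
      then obtain \<tau> where \<tau>: "singular_simplex (Suc p) ?Y \<tau>"
        "\<And>k. 0 < Suc p \<Longrightarrow> k \<le> Suc p \<Longrightarrow> singular_face (Suc p) k \<tau> = \<psi> (singular_face (Suc p) k \<sigma>)"
      proof (rule simplex_extension[of n ?Y "Suc p" "\<lambda>k. \<psi> (singular_face (Suc p) k \<sigma>)"])
        show "singular_simplex (Suc p - 1) ?Y (\<psi> (singular_face (Suc p) k \<sigma>))" if "k \<le> Suc p" for k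
        proof -
          have "C (singular_face (Suc p) k \<sigma> ` standard_simplex p) \<subseteq> C (\<sigma> ` standard_simplex (Suc p))"
            using image_singular_face[OF that] img[OF \<sigma>] by (intro mono)
          then show ?thesis
            using \<psi>(1)[OF face_simplex[OF \<sigma> that]] singular_simplex_mono
            by (fastforce simp: carried_def)
        qed
        show "singular_face (Suc p - 1) j (\<psi> (singular_face (Suc p) k \<sigma>))
            = singular_face (Suc p - 1) (k - 1) (\<psi> (singular_face (Suc p) j \<sigma>))"
          if jk: "2 \<le> Suc p" "j < k" "k \<le> Suc p" for j k
        proof -
          have "singular_face p j (\<psi> (singular_face (Suc p) k \<sigma>))
              = \<psi>0 (singular_face p j (singular_face (Suc p) k \<sigma>))"
            using \<psi>0[OF face_simplex[OF \<sigma>, of k]] jk by (auto simp: faces_def)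
          moreover have "singular_face p (k - 1) (\<psi> (singular_face (Suc p) j \<sigma>))
              = \<psi>0 (singular_face p (k - 1) (singular_face (Suc p) j \<sigma>))"
            using \<psi>0[OF face_simplex[OF \<sigma>, of j]] jk by (auto simp: faces_def)
          ultimately show ?thesis using singular_face_face[OF jk, of \<sigma>] by simp
        qed
      qed (use True in auto)
      then have "R \<sigma> \<tau>" by (auto simp: R_def carried_def faces_def)
      then show ?thesis by blast
    qed
    have R: "R (simplex_map (Suc p) a \<sigma>) (simplex_map (Suc p) b \<tau>) \<and>
        simplex_map (Suc p) b (simplex_map (Suc p) b \<tau>) = \<tau>"
      if "\<sigma> \<in> singular_simplex_set (Suc p) X" "R \<sigma> \<tau>" for \<sigma> \<tau>
    proof -
      have \<sigma>: "singular_simplex (Suc p) X \<sigma>" using that by simp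
      have \<tau>: "carried (Suc p) \<sigma> \<tau>" "faces (Suc p) \<psi> \<sigma> \<tau>" using that by (auto simp: R_def)
      have "faces (Suc p) \<psi> (simplex_map (Suc p) a \<sigma>) (simplex_map (Suc p) b \<tau>)"
        using \<tau>(2) \<psi>(2)[OF face_simplex[OF \<sigma>]]
        by (simp add: faces_def singular_face_simplex_map_commute)
      then show ?thesis using carried_antipode[OF \<sigma> \<tau>(1)] by (simp add: R_def)
    qed
    obtain \<psi>' where "\<And>\<sigma>. \<sigma> \<in> singular_simplex_set (Suc p) X \<Longrightarrow> R \<sigma> (\<psi>' \<sigma>)"
      "\<And>\<sigma>. \<sigma> \<in> singular_simplex_set (Suc p) X \<Longrightarrow>
         \<psi>' (simplex_map (Suc p) a \<sigma>) = simplex_map (Suc p) b (\<psi>' \<sigma>)"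
      by (rule equivariant_choice[of "singular_simplex_set (Suc p) X" "simplex_map (Suc p) a" R
            "simplex_map (Suc p) b"]) (use \<alpha> ex R in auto)
    then have "P (Suc p) \<psi>' \<and> Q p \<psi> \<psi>'"
      unfolding P_def Q_def R_def by blast
    then show ?thesis by blast
  qed
  ultimately obtain \<phi> where \<phi>: "\<And>p. P p (\<phi> p)" "\<And>p. Q p (\<phi> p) (\<phi> (Suc p))"
    using dependent_nat_choice[of P Q] by blast
  show ?thesis
  proof (rule that[of \<phi>])
    show "singular_simplex p (subtopology Y (C (\<sigma> ` standard_simplex p))) (\<phi> p \<sigma>)"
      "\<phi> p (simplex_map p a \<sigma>) = simplex_map p b (\<phi> p \<sigma>)"
      if "p \<le> Suc n" "singular_simplex p X \<sigma>" for p \<sigma>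
      using \<phi>(1)[of p] that by (auto simp: P_def carried_def)
    show "singular_face (Suc p) k (\<phi> (Suc p) \<sigma>) = \<phi> p (singular_face (Suc p) k \<sigma>)"
      if "p \<le> n" "singular_simplex (Suc p) X \<sigma>" "k \<le> Suc p" for p \<sigma> k
      using \<phi>(2)[of p] that by (auto simp: Q_def faces_def)
  qed
qed

section \<open>A Borsuk-Ulam theorem for carriers\<close>

text \<open>
  The points of \<open>C {x}\<close> are the values at \<open>x\<close> of a set-valued odd map, to be composed with \<open>F\<close>; the
  values of \<open>C\<close> on larger sets carry the selection on singular simplices. By \<open>usc\<close> a zero over a
  small simplex is a zero over a single point, so that no limit has to be taken. Without zeros,
  \<open>F\<close> would carry the selected image of a subdivided tower of the sphere into punctured space.
\<close>
lemma borsuk_ulam_carrier: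
  fixes Y :: "'b topology" and C :: "(nat \<Rightarrow> real) set \<Rightarrow> 'b set"
  assumes d: "0 < d"
    and b: "continuous_map Y Y b" "\<And>y. y \<in> topspace Y \<Longrightarrow> b (b y) = y"
    and mono: "\<And>S T. S \<subseteq> T \<Longrightarrow> T \<subseteq> topspace (nsphere d) \<Longrightarrow> C S \<subseteq> C T"
    and equi: "\<And>S. S \<subseteq> topspace (nsphere d) \<Longrightarrow> b ` C S \<subseteq> C (uminus ` S)"
    and conn: "\<And>S. S \<subseteq> topspace (nsphere d) \<Longrightarrow> S \<noteq> {} \<Longrightarrow>
      n_connected (d - 1) (subtopology Y (C S))"
    and usc: "\<And>x. x \<in> topspace (nsphere d) \<Longrightarrow> \<exists>V. openin (nsphere d) V \<and> x \<in> V \<and> C V \<subseteq> C {x}"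
    and F: "continuous_map Y (Euclidean_space d) F" "\<And>y. y \<in> topspace Y \<Longrightarrow> F (b y) = - F y"
  obtains x y where "x \<in> topspace (nsphere d)" "y \<in> topspace Y \<inter> C {x}" "F y = 0"
proof (rule ccontr)
  note zero_found = that
  assume "\<not> thesis"
  then have nonzero: "F y \<noteq> 0" if "x \<in> topspace (nsphere d)" "y \<in> topspace Y \<inter> C {x}" for x y
    using zero_found that by blast
  let ?S = "nsphere d" and ?Z = "subtopology (Euclidean_space d) (- {0})"
  obtain V where V: "\<And>x. x \<in> topspace ?S \<Longrightarrow> openin ?S (V x) \<and> x \<in> V x \<and> C (V x) \<subseteq> C {x}"
    using usc by metis
  obtain c where c: "antipodal_tower d ?S uminus c"
    using antipodal_tower_nsphere[OF d] .
  have cover: "U \<in> V ` topspace ?S \<Longrightarrow> openin ?S U" "topspace ?S \<subseteq> \<Union> (V ` topspace ?S)" for U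
    using V by auto
  obtain e where e: "antipodal_tower d ?S uminus e"
    and small: "\<And>k \<sigma>. k \<le> d \<Longrightarrow> \<sigma> \<in> Poly_Mapping.keys (e k) \<Longrightarrow>
      \<exists>U\<in>V ` topspace ?S. \<sigma> ` standard_simplex k \<subseteq> U"
    using antipodal_tower_small[OF c continuous_map_nsphere_antipode cover] by auto
  have fixed_point_free: "- (- x) = x \<and> - x \<noteq> x" if "x \<in> topspace ?S" for x :: "nat \<Rightarrow> real"
  proof -
    have "- x \<noteq> x"
    proof
      assume "- x = x"
      then have "x i = 0" for i by (metis uminus_apply equal_neg_zero)
      then show False using that by (simp add: nsphere)
    qed
    then show ?thesis by simp
  qed
  obtain \<phi> where \<phi>:
    "\<And>p \<sigma>. p \<le> Suc (d - 1) \<Longrightarrow> singular_simplex p ?S \<sigma> \<Longrightarrow>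
       singular_simplex p (subtopology Y (C (\<sigma> ` standard_simplex p))) (\<phi> p \<sigma>)"
    "\<And>p \<sigma>. p \<le> Suc (d - 1) \<Longrightarrow> singular_simplex p ?S \<sigma> \<Longrightarrow>
       \<phi> p (simplex_map p uminus \<sigma>) = simplex_map p b (\<phi> p \<sigma>)"
    "\<And>p \<sigma> k. p \<le> d - 1 \<Longrightarrow> singular_simplex (Suc p) ?S \<sigma> \<Longrightarrow> k \<le> Suc p \<Longrightarrow>
       singular_face (Suc p) k (\<phi> (Suc p) \<sigma>) = \<phi> p (singular_face (Suc p) k \<sigma>)"
    by (rule equivariant_selection[where X = ?S and a = uminus and Y = Y and b = b and C = C and n = "d - 1"])
      (use b mono equi conn continuous_map_nsphere_antipode fixed_point_free in auto)
  have d': "Suc (d - 1) = d" using d by simp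
  have "antipodal_tower d ?Z uminus
      (\<lambda>k. frag_extend (frag_of \<circ> (\<lambda>\<sigma>. simplex_map k F (\<phi> k \<sigma>))) (e k))"
  proof (rule antipodal_tower_image[OF e])
    fix k \<sigma> assume k: "k \<le> d" and key: "\<sigma> \<in> Poly_Mapping.keys (e k)"
    have \<sigma>: "singular_simplex k ?S \<sigma>"
      using e k key by (auto simp: antipodal_tower_def singular_chain_def)
    obtain x where x: "x \<in> topspace ?S" "\<sigma> ` standard_simplex k \<subseteq> V x"
      using small[OF k key] by auto
    have "C (\<sigma> ` standard_simplex k) \<subseteq> C (V x)"
      using x V openin_subset by (intro mono) blast+
    then have sub: "C (\<sigma> ` standard_simplex k) \<subseteq> C {x}" using V x by blast
    have \<tau>: "singular_simplex k Y (\<phi> k \<sigma>)" "\<phi> k \<sigma> ` standard_simplex k \<subseteq> C {x}"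
      using \<phi>(1)[OF _ \<sigma>] sub k d' by (auto simp: singular_simplex_subtopology)
    have "F (\<phi> k \<sigma> v) \<noteq> 0" if "v \<in> standard_simplex k" for v
    proof (rule nonzero[OF x(1)])
      have "\<phi> k \<sigma> v \<in> topspace Y"
        using \<tau>(1) that by (auto simp: singular_simplex_def continuous_map_def)
      then show "\<phi> k \<sigma> v \<in> topspace Y \<inter> C {x}" using \<tau>(2) that by auto
    qed
    then show "singular_simplex k ?Z (simplex_map k F (\<phi> k \<sigma>))"
      using singular_simplex_simplex_map[OF \<tau>(1) F(1)]
      by (auto simp: singular_simplex_subtopology simplex_map_def)
  next
    fix k \<sigma> assume k: "k \<le> d" and \<sigma>: "singular_simplex k ?S \<sigma>"
    have "singular_simplex k Y (\<phi> k \<sigma>)"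
      using \<phi>(1)[OF _ \<sigma>] k d' by (auto simp: singular_simplex_subtopology)
    then have "simplex_map k (F \<circ> b) (\<phi> k \<sigma>) = simplex_map k (uminus \<circ> F) (\<phi> k \<sigma>)"
      by (rule simplex_map_eq) (simp add: F(2))
    then show "simplex_map k F (\<phi> k (simplex_map k uminus \<sigma>)) = simplex_map k uminus (simplex_map k F (\<phi> k \<sigma>))"
      using \<phi>(2)[OF _ \<sigma>] k d' by (simp add: simplex_map_compose)
  next
    fix k \<sigma> i assume "k < d" "singular_simplex (Suc k) ?S \<sigma>" "i \<le> Suc k"
    then show "singular_face (Suc k) i (simplex_map (Suc k) F (\<phi> (Suc k) \<sigma>))
        = simplex_map k F (\<phi> k (singular_face (Suc k) i \<sigma>))"
      using \<phi>(3)[of k \<sigma> i] by (simp add: singular_face_simplex_map_commute)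
  qed
  then show False using no_antipodal_tower_punctured_space by blast
qed

section \<open>Radon-type intersections from signed weights\<close>

lemma sum_fun_apply: "(\<Sum>i\<in>I. g i) x = (\<Sum>i\<in>I. g i x)"
  for g :: "'i \<Rightarrow> 'a \<Rightarrow> 'b::comm_monoid_add"
  by (induction I rule: infinite_finite_induct) auto

text \<open>
  The positive and the negative weights both add up to one half, so doubling turns the two halves of the
  vanishing sum into convex combinations.
\<close>
lemma signed_zero_imp_hulls_meet:
  fixes p :: "'i \<Rightarrow> 'a \<Rightarrow> real"
  assumes I: "finite I" "\<And>i. i \<in> I \<Longrightarrow> 0 \<le> u i" "(\<Sum>i\<in>I. u i) = 1"
    and weights: "(\<Sum>i\<in>I. u i * (if e i then 1 else - 1)) = 0"
    and points: "\<And>j. (\<Sum>i\<in>I. u i * (if e i then 1 else - 1) * p i j) = 0"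
  shows "convex hull (p ` {i \<in> I. e i}) \<inter> convex hull (p ` {i \<in> I. \<not> e i}) \<noteq> {}"
proof -
  let ?A = "{i \<in> I. e i}" and ?B = "{i \<in> I. \<not> e i}"
  have split: "(\<Sum>i\<in>I. g i) = (\<Sum>i\<in>?A. g i) + (\<Sum>i\<in>?B. g i)" for g :: "'i \<Rightarrow> real"
  proof -
    have "I = ?A \<union> ?B" by blast
    then have "(\<Sum>i\<in>I. g i) = (\<Sum>i\<in>?A \<union> ?B. g i)" by presburger
    also have "\<dots> = (\<Sum>i\<in>?A. g i) + (\<Sum>i\<in>?B. g i)"
      using I(1) by (intro sum.union_disjoint) auto
    finally show ?thesis .
  qed
  have signed: "(\<Sum>i\<in>I. u i * (if e i then 1 else - 1) * g i) = (\<Sum>i\<in>?A. u i * g i) - (\<Sum>i\<in>?B. u i * g i)"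
    for g :: "'i \<Rightarrow> real"
    by (subst split) (simp add: sum_negf)
  have eq: "(\<Sum>i\<in>?A. u i) = (\<Sum>i\<in>?B. u i)" using weights signed[of "\<lambda>_. 1"] by simp
  then have half: "(\<Sum>i\<in>?A. 2 * u i) = 1" "(\<Sum>i\<in>?B. 2 * u i) = 1"
    using I(3) split[of u] by (simp_all flip: sum_distrib_left)
  have "(\<Sum>i\<in>?A. (2 * u i) *\<^sub>R p i) \<in> convex hull (p ` ?A)"
    using I half by (intro convex_sum convex_convex_hull) (auto intro: hull_inc)
  moreover have "(\<Sum>i\<in>?B. (2 * u i) *\<^sub>R p i) \<in> convex hull (p ` ?B)"
    using I half by (intro convex_sum convex_convex_hull) (auto intro: hull_inc)
  moreover have "(\<Sum>i\<in>?A. (2 * u i) *\<^sub>R p i) = (\<Sum>i\<in>?B. (2 * u i) *\<^sub>R p i)"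
  proof
    fix j
    have "(\<Sum>i\<in>?A. u i * p i j) = (\<Sum>i\<in>?B. u i * p i j)"
      using points[of j] signed[of "\<lambda>i. p i j"] by simp
    then show "(\<Sum>i\<in>?A. (2 * u i) *\<^sub>R p i) j = (\<Sum>i\<in>?B. (2 * u i) *\<^sub>R p i) j"
      by (simp add: sum_fun_apply scaleR_fun_def mult.assoc flip: sum_distrib_left)
  qed
  ultimately show ?thesis by auto
qed

section \<open>Fiber complexes spanned by the closed sets\<close>

lemma geometric_realization_subtopology:
  "subtopology (powertop_real UNIV) (topspace (geometric_realization K)) = geometric_realization K"
  by (simp add: geometric_realization_def)

lemma topspace_geometric_realization_mono:
  "K \<subseteq> K' \<Longrightarrow> topspace (geometric_realization K) \<subseteq> topspace (geometric_realization K')"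
  by (auto simp: geometric_realization_def)

lemma fiber_complex_mono:
  "(\<And>w. w \<in> U \<Longrightarrow> D w \<subseteq> D' w) \<Longrightarrow> fiber_complex K U D \<subseteq> fiber_complex K U D'"
  unfolding fiber_complex_def induced_complex_def by blast

text \<open>
  Admissibility speaks of nonempty fibers over all of \<open>W\<close>. Here empty fibers are allowed as long as
  the other ones lie over a member of \<open>L\<close>: restricting to this member, the empty fibers can be
  filled arbitrarily without changing the complex.
\<close>
lemma fiber_complex_connected:
  fixes D :: "'w \<Rightarrow> nat set"
  assumes "admissible_selection_structure d W K L"
    and "\<And>w. w \<in> W \<Longrightarrow> finite (D w)" and L: "{w \<in> W. D w \<noteq> {}} \<in> L"
  shows "n_connected (d - 1) (geometric_realization (fiber_complex K W D))"
proof -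
  define D' where "D' w = (if D w = {} then {0} else D w)" for w
  let ?T = "{w \<in> W. D w \<noteq> {}}"
  have D': "D w \<noteq> {} \<Longrightarrow> D' w = D w" for w by (simp add: D'_def)
  have "\<sigma> \<in> induced_complex K W \<and> (\<forall>w\<in>\<sigma>. y w \<in> D w) \<longleftrightarrow>
      \<sigma> \<in> induced_complex K ?T \<and> (\<forall>w\<in>\<sigma>. y w \<in> D' w)" for \<sigma> y
  proof (intro iffI conjI)
    assume l: "\<sigma> \<in> induced_complex K W \<and> (\<forall>w\<in>\<sigma>. y w \<in> D w)"
    then have "\<forall>w\<in>\<sigma>. D w \<noteq> {}" by blast
    then show "\<sigma> \<in> induced_complex K ?T" "\<forall>w\<in>\<sigma>. y w \<in> D' w"
      using l by (auto simp: induced_complex_def D')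
  next
    assume r: "\<sigma> \<in> induced_complex K ?T \<and> (\<forall>w\<in>\<sigma>. y w \<in> D' w)"
    then have "\<forall>w\<in>\<sigma>. D w \<noteq> {}" by (auto simp: induced_complex_def)
    then show "\<sigma> \<in> induced_complex K W" "\<forall>w\<in>\<sigma>. y w \<in> D w"
      using r by (auto simp: induced_complex_def D')
  qed
  then have eq: "fiber_complex K W D = fiber_complex K ?T D'"
    unfolding fiber_complex_def by presburger
  have "\<forall>D :: 'w \<Rightarrow> nat set. (\<forall>w\<in>W. finite (D w) \<and> D w \<noteq> {}) \<longrightarrow>
      (\<forall>U\<in>L. n_connected (d - 1) (geometric_realization (fiber_complex K U D)))"
    using assms(1) unfolding admissible_selection_structure_def by (elim conjE)
  moreover have "\<forall>w\<in>W. finite (D' w) \<and> D' w \<noteq> {}"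
    using assms(2) by (simp add: D'_def)
  ultimately have "\<forall>U\<in>L. n_connected (d - 1) (geometric_realization (fiber_complex K U D'))"
    by (elim allE[of _ D'] impE)
  then show ?thesis unfolding eq using L by (rule bspec)
qed

lemma ex_facet_superset:
  assumes "finite W" "K \<subseteq> Pow W" "\<sigma> \<in> K"
  obtains \<tau> where "\<tau> \<in> facets K" "\<sigma> \<subseteq> \<tau>"
proof -
  have "finite K" using assms finite_subset by auto
  from finite_has_maximal2[OF this assms(3)]
  obtain \<tau> where "\<tau> \<in> K" "\<sigma> \<subseteq> \<tau>" "\<forall>\<rho>\<in>K. \<tau> \<subseteq> \<rho> \<longrightarrow> \<tau> = \<rho>"
    by blast
  then show ?thesis using that[of \<tau>] by (auto simp: facets_def)
qed

definition signed_set :: "('w \<Rightarrow> nat \<Rightarrow> (nat \<Rightarrow> real) set) \<Rightarrow> 'w \<Rightarrow> nat \<Rightarrow> (nat \<Rightarrow> real) set" where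
  "signed_set A w n = (if even n then A w (n div 2) else uminus ` A w (n div 2))"

text \<open>
  Labels are used for whole sets of points because carriers have to be assigned to singular simplices.
\<close>
definition active_labels ::
    "nat \<Rightarrow> ('w \<Rightarrow> nat \<Rightarrow> (nat \<Rightarrow> real) set) \<Rightarrow> (nat \<Rightarrow> real) set \<Rightarrow> 'w \<Rightarrow> nat set" where
  "active_labels m A Z w = {n. n div 2 \<in> {1..m} \<and> Z \<inter> signed_set A w n \<noteq> {}}"

lemma signed_set_flip: "signed_set A w (flip n) = uminus ` signed_set A w n"
  by (auto simp: signed_set_def image_image)

lemma active_labels_mono: "S \<subseteq> T \<Longrightarrow> active_labels m A S w \<subseteq> active_labels m A T w"
  by (auto simp: active_labels_def)

lemma active_labels_antipode: "n \<in> active_labels m A S w \<Longrightarrow> flip n \<in> active_labels m A (uminus ` S) w"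
proof -
  assume n: "n \<in> active_labels m A S w"
  then obtain x where "x \<in> S" "x \<in> signed_set A w n" by (auto simp: active_labels_def)
  then have "- x \<in> uminus ` S \<inter> signed_set A w (flip n)" by (simp add: signed_set_flip)
  then show ?thesis using n by (auto simp: active_labels_def)
qed

lemma finite_signed_labels: "finite {n::nat. n div 2 \<in> {1..m}}"
  by (rule finite_subset[of _ "{..2 * m + 1}"]) auto

definition flip_fiber :: "('w \<times> nat \<Rightarrow> real) \<Rightarrow> 'w \<times> nat \<Rightarrow> real" where
  "flip_fiber f = f \<circ> map_prod id flip"

lemma map_prod_flip_flip [simp]: "map_prod id flip (map_prod id flip v) = v"
  by (cases v) simp

lemma flip_fiber_geometric_realization:
  assumes "\<And>w n. n \<in> D w \<Longrightarrow> flip n \<in> D' w"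
  shows "flip_fiber ` topspace (geometric_realization (fiber_complex K W D))
    \<subseteq> topspace (geometric_realization (fiber_complex K W D'))"
proof clarify
  let ?r = "map_prod id flip :: 'a \<times> nat \<Rightarrow> _"
  fix f assume "f \<in> topspace (geometric_realization (fiber_complex K W D))"
  then have f: "\<forall>v. 0 \<le> f v" "{v. f v \<noteq> 0} \<in> fiber_complex K W D" "(\<Sum>v | f v \<noteq> 0. f v) = 1"
    by (auto simp: geometric_realization_def)
  have supp: "{v. flip_fiber f v \<noteq> 0} = ?r ` {v. f v \<noteq> 0}"
  proof (intro Set.set_eqI iffI)
    fix v assume "v \<in> {v. flip_fiber f v \<noteq> 0}"
    then have "?r v \<in> {v. f v \<noteq> 0}" by (simp add: flip_fiber_def)
    then show "v \<in> ?r ` {v. f v \<noteq> 0}" by (rule image_eqI[rotated]) simp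
  next
    fix v assume "v \<in> ?r ` {v. f v \<noteq> 0}"
    then show "v \<in> {v. flip_fiber f v \<noteq> 0}" by (clarsimp simp: flip_fiber_def)
  qed
  obtain \<sigma> y where \<sigma>: "{v. f v \<noteq> 0} = (\<lambda>w. (w, y w)) ` \<sigma>" "\<sigma> \<in> induced_complex K W" "\<forall>w\<in>\<sigma>. y w \<in> D w"
    using f(2) unfolding fiber_complex_def by blast
  have supp_eq: "{v. flip_fiber f v \<noteq> 0} = (\<lambda>w. (w, flip (y w))) ` \<sigma>"
    unfolding supp \<sigma>(1) by (auto simp: image_image)
  then have "{v. flip_fiber f v \<noteq> 0} \<in> fiber_complex K W D'"
    using \<sigma>(2,3) assms unfolding fiber_complex_def
    by (intro CollectI exI[of _ \<sigma>] exI[of _ "\<lambda>w. flip (y w)"] conjI) blast+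
  moreover have "(\<Sum>v | flip_fiber f v \<noteq> 0. flip_fiber f v) = 1"
  proof -
    have "inj_on ?r {v. f v \<noteq> 0}" by (rule inj_on_inverseI[of _ ?r]) simp
    then have "(\<Sum>v | flip_fiber f v \<noteq> 0. flip_fiber f v) = (\<Sum>v | f v \<noteq> 0. flip_fiber f (?r v))"
      unfolding supp by (simp add: sum.reindex)
    then show ?thesis using f(3) by (simp add: flip_fiber_def)
  qed
  moreover have "\<forall>v. 0 \<le> flip_fiber f v" using f(1) by (simp add: flip_fiber_def)
  ultimately show "flip_fiber f \<in> topspace (geometric_realization (fiber_complex K W D'))"
    by (simp add: geometric_realization_def)
qed

text \<open>
  Otherwise the covering hypothesis, applied to the elements \<open>w\<close> without an active label,
  would say that their signed sets cover the sphere, in particular the points of \<open>Z\<close>.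
\<close>
lemma active_labels_in_family:
  assumes adm: "admissible_selection_structure d W K L"
    and cover: "\<And>W'. W' \<subseteq> W \<Longrightarrow> W - W' \<notin> L \<Longrightarrow>
           topspace (nsphere d) = (\<Union>w\<in>W'. \<Union>i\<in>{1..m}. A w i \<union> uminus ` A w i)"
    and Z: "Z \<subseteq> topspace (nsphere d)" "Z \<noteq> {}"
  shows "{w \<in> W. active_labels m A Z w \<noteq> {}} \<in> L"
proof (rule ccontr)
  let ?T = "{w \<in> W. active_labels m A Z w \<noteq> {}}"
  assume notin: "?T \<notin> L"
  obtain x where x: "x \<in> Z" using Z(2) by blast
  have "W - (W - ?T) = ?T" by blast
  then have "topspace (nsphere d) = (\<Union>w\<in>W - ?T. \<Union>i\<in>{1..m}. A w i \<union> uminus ` A w i)"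
    using cover[of "W - ?T"] notin by simp
  then have "x \<in> (\<Union>w\<in>W - ?T. \<Union>i\<in>{1..m}. A w i \<union> uminus ` A w i)" using x Z(1) by blast
  then obtain w i where w: "w \<in> W - ?T" "i \<in> {1..m}" "x \<in> A w i \<union> uminus ` A w i" by blast
  have "2 * i \<in> active_labels m A Z w \<or> Suc (2 * i) \<in> active_labels m A Z w"
    using w(2,3) x by (auto simp: active_labels_def signed_set_def)
  then show False using w(1) by blast
qed

lemma closedin_signed_set:
  assumes "closedin (nsphere d) (A w (n div 2))"
  shows "closedin (nsphere d) (signed_set A w n)"
proof (cases "even n")
  case True
  then show ?thesis using assms by (simp add: signed_set_def)
next
  case False
  have antipode: "- x \<in> topspace (nsphere d)" if "x \<in> topspace (nsphere d)" for x
    using continuous_map_nsphere_antipode[of d] that by (auto simp: continuous_map_def)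
  have "closedin (nsphere d) {x \<in> topspace (nsphere d). - x \<in> A w (n div 2)}"
    by (rule closedin_continuous_map_preimage[OF continuous_map_nsphere_antipode assms])
  moreover have "{x \<in> topspace (nsphere d). - x \<in> A w (n div 2)} = uminus ` A w (n div 2)"
  proof (intro Set.set_eqI iffI)
    fix x assume "x \<in> {x \<in> topspace (nsphere d). - x \<in> A w (n div 2)}"
    then show "x \<in> uminus ` A w (n div 2)" by (intro image_eqI[of _ _ "- x"]) auto
  next
    fix x assume "x \<in> uminus ` A w (n div 2)"
    then obtain a where a: "a \<in> A w (n div 2)" "x = - a" by blast
    then have "a \<in> topspace (nsphere d)" using assms closedin_subset by blast
    then show "x \<in> {x \<in> topspace (nsphere d). - x \<in> A w (n div 2)}" using a antipode by simp
  qed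
  ultimately show ?thesis using False by (simp add: signed_set_def)
qed

text \<open>
  Only finitely many closed sets are involved; remove those that do not contain \<open>x\<close>.
\<close>
lemma active_labels_upper_semicontinuous:
  assumes W: "finite W"
    and closed: "\<And>w i. w \<in> W \<Longrightarrow> i \<in> {1..m} \<Longrightarrow> closedin (nsphere d) (A w i)"
    and x: "x \<in> topspace (nsphere d)"
  shows "\<exists>V. openin (nsphere d) V \<and> x \<in> V \<and>
    (\<forall>w\<in>W. active_labels m A V w \<subseteq> active_labels m A {x} w)"
proof -
  let ?I = "{v \<in> W \<times> {n. n div 2 \<in> {1..m}}. x \<notin> signed_set A (fst v) (snd v)}"
  let ?B = "\<Union>v\<in>?I. signed_set A (fst v) (snd v)"
  have "finite ?I" using W finite_signed_labels by (intro finite_subset[of ?I "W \<times> {n. n div 2 \<in> {1..m}}"]) auto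
  then have "closedin (nsphere d) ?B"
    by (intro closedin_Union) (auto intro!: closedin_signed_set closed)
  then have "openin (nsphere d) (topspace (nsphere d) - ?B)" by blast
  moreover have "x \<in> topspace (nsphere d) - ?B" using x by blast
  moreover have "active_labels m A (topspace (nsphere d) - ?B) w \<subseteq> active_labels m A {x} w"
    if "w \<in> W" for w
  proof
    fix n assume "n \<in> active_labels m A (topspace (nsphere d) - ?B) w"
    then have n: "n div 2 \<in> {1..m}" and "\<exists>z. z \<notin> ?B \<and> z \<in> signed_set A w n"
      unfolding active_labels_def by blast+
    then have "(w, n) \<notin> ?I" by force
    then show "n \<in> active_labels m A {x} w" using n that by (simp add: active_labels_def)
  qed
  ultimately show ?thesis by blast
qed

text \<open>
  The affine extension of the map sending the vertex \<open>(w, n)\<close> to plus or minus the point \<open>X w (n div 2)\<close>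
  with an additional last coordinate 1, according to the sign of \<open>n\<close>. The additional coordinate, at
  position \<open>d - 1\<close>, forces the positive and negative weights of a zero to balance.
\<close>
definition signed_moment ::
    "nat \<Rightarrow> nat \<Rightarrow> 'w set \<Rightarrow> ('w \<Rightarrow> nat \<Rightarrow> nat \<Rightarrow> real) \<Rightarrow> ('w \<times> nat \<Rightarrow> real) \<Rightarrow> nat \<Rightarrow> real" where
  "signed_moment d m W X f = (\<lambda>j. \<Sum>v\<in>W \<times> {n. n div 2 \<in> {1..m}}.
     f v * (if even (snd v) then 1 else - 1) * ((X (fst v) (snd v div 2))(d - 1 := 1)) j)"

lemma continuous_map_signed_moment:
  assumes "0 < d" "finite W"
    and X: "\<And>w i. w \<in> W \<Longrightarrow> i \<in> {1..m} \<Longrightarrow> X w i \<in> topspace (Euclidean_space (d - 1))"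
  shows "continuous_map (powertop_real UNIV) (Euclidean_space d) (signed_moment d m W X)"
  unfolding Euclidean_space_def continuous_map_in_subtopology continuous_map_componentwise_UNIV
proof (intro conjI allI funcsetI)
  have fin: "finite (W \<times> {n. n div 2 \<in> {1..m}})"
    using assms(2) finite_signed_labels by (rule finite_cartesian_product)
  show "continuous_map (powertop_real UNIV) euclideanreal (\<lambda>f. signed_moment d m W X f j)" for j
    unfolding signed_moment_def
    by (intro continuous_map_sum[OF fin] continuous_map_real_mult continuous_map_product_projection
        continuous_map_canonical_const UNIV_I)
  fix f
  have "signed_moment d m W X f j = 0" if "d \<le> j" for j
    unfolding signed_moment_def
  proof (intro sum.neutral ballI)
    fix v assume "v \<in> W \<times> {n. n div 2 \<in> {1..m}}"
    then have "X (fst v) (snd v div 2) \<in> topspace (Euclidean_space (d - 1))"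
      by (intro X) auto
    then have "X (fst v) (snd v div 2) j = 0" using that by (simp add: topspace_Euclidean_space)
    then show "f v * (if even (snd v) then 1 else - 1) * ((X (fst v) (snd v div 2))(d - 1 := 1)) j = 0"
      using that assms(1) by simp
  qed
  then show "signed_moment d m W X f \<in> {x. \<forall>i\<ge>d. x i = 0}" by simp
qed

lemma signed_moment_flip_fiber:
  "signed_moment d m W X (flip_fiber f) = - signed_moment d m W X f"
proof
  fix j
  have "signed_moment d m W X (flip_fiber f) j
      = (\<Sum>v\<in>W \<times> {n. n div 2 \<in> {1..m}}. - (f v * (if even (snd v) then 1 else - 1) *
          ((X (fst v) (snd v div 2))(d - 1 := 1)) j))"
    unfolding signed_moment_def
    by (rule sum.reindex_bij_witness[where i = "map_prod id flip" and j = "map_prod id flip"])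
      (auto simp: flip_fiber_def)
  then show "signed_moment d m W X (flip_fiber f) j = (- signed_moment d m W X f) j"
    by (simp add: signed_moment_def sum_negf)
qed

lemma continuous_map_flip_fiber: "continuous_map (powertop_real UNIV) (powertop_real UNIV) flip_fiber"
  unfolding continuous_map_componentwise_UNIV flip_fiber_def o_def
  by (auto intro: continuous_map_product_projection)

lemma signed_moment_zero_imp_hulls_meet:
  assumes "0 < d" "finite W"
    and X: "\<And>w i. w \<in> W \<Longrightarrow> i \<in> {1..m} \<Longrightarrow> X w i \<in> topspace (Euclidean_space (d - 1))"
    and D: "\<And>w. w \<in> W \<Longrightarrow> D w \<subseteq> {n. n div 2 \<in> {1..m}}"
    and f: "f \<in> topspace (geometric_realization (fiber_complex K W D))"
    and zero: "signed_moment d m W X f = 0"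
  obtains \<sigma> y where "\<sigma> \<in> induced_complex K W" "\<And>w. w \<in> \<sigma> \<Longrightarrow> y w \<in> D w"
    "convex hull ((\<lambda>w. X w (y w div 2)) ` {w \<in> \<sigma>. even (y w)}) \<inter>
     convex hull ((\<lambda>w. X w (y w div 2)) ` {w \<in> \<sigma>. odd (y w)}) \<noteq> {}"
proof -
  let ?N = "{n. n div 2 \<in> {1..m}}"
  have f: "\<forall>v. 0 \<le> f v" "{v. f v \<noteq> 0} \<in> fiber_complex K W D" "(\<Sum>v | f v \<noteq> 0. f v) = 1"
    using f by (auto simp: geometric_realization_def)
  obtain \<sigma> y where supp: "{v. f v \<noteq> 0} = (\<lambda>w. (w, y w)) ` \<sigma>"
    and \<sigma>: "\<sigma> \<in> induced_complex K W" and y: "\<forall>w\<in>\<sigma>. y w \<in> D w"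
    using f(2) unfolding fiber_complex_def by blast
  have \<sigma>W: "\<sigma> \<subseteq> W" using \<sigma> by (simp add: induced_complex_def)
  have fin: "finite \<sigma>" using \<sigma>W assms(2) by (rule finite_subset)
  have inj: "inj_on (\<lambda>w. (w, y w)) \<sigma>" by (auto simp: inj_on_def)
  have reindex: "(\<Sum>v | f v \<noteq> 0. g v) = (\<Sum>w\<in>\<sigma>. g (w, y w))" for g :: "_ \<Rightarrow> real"
    unfolding supp using inj by (simp add: sum.reindex)
  have sum: "(\<Sum>w\<in>\<sigma>. f (w, y w)) = 1" using f(3) by (simp add: reindex)
  have moment: "(\<Sum>w\<in>\<sigma>. f (w, y w) * (if even (y w) then 1 else - 1) * ((X w (y w div 2))(d - 1 := 1)) j) = 0"
    for j
  proof -
    let ?g = "\<lambda>v. f v * (if even (snd v) then 1 else - 1) * ((X (fst v) (snd v div 2))(d - 1 := 1)) j"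
    have "{v. f v \<noteq> 0} \<subseteq> W \<times> ?N" unfolding supp using \<sigma>W y D by blast
    then have "(\<Sum>v\<in>W \<times> ?N. ?g v) = (\<Sum>v | f v \<noteq> 0. ?g v)"
      using assms(2) finite_signed_labels by (intro sum.mono_neutral_right) auto
    moreover have "(\<Sum>v\<in>W \<times> ?N. ?g v) = 0"
      using fun_cong[OF zero, of j] by (simp add: signed_moment_def)
    ultimately have "(\<Sum>v | f v \<noteq> 0. ?g v) = 0" by simp
    then show ?thesis by (simp only: reindex fst_conv snd_conv)
  qed
  have "convex hull ((\<lambda>w. X w (y w div 2)) ` {w \<in> \<sigma>. even (y w)}) \<inter>
     convex hull ((\<lambda>w. X w (y w div 2)) ` {w \<in> \<sigma>. \<not> even (y w)}) \<noteq> {}"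
  proof (rule signed_zero_imp_hulls_meet[where u = "\<lambda>w. f (w, y w)"])
    show "(\<Sum>w\<in>\<sigma>. f (w, y w) * (if even (y w) then 1 else - 1)) = 0"
      using moment[of "d - 1"] by simp
    show "(\<Sum>w\<in>\<sigma>. f (w, y w) * (if even (y w) then 1 else - 1) * X w (y w div 2) j) = 0" for j
    proof (cases "j = d - 1")
      case True
      have "X w (y w div 2) j = 0" if "w \<in> \<sigma>" for w
      proof -
        have "w \<in> W" "y w div 2 \<in> {1..m}" using that \<sigma>W y D by blast+
        then show ?thesis using X True by (simp add: topspace_Euclidean_space)
      qed
      then show ?thesis by simp
    next
      case False
      then show ?thesis using moment[of j] by simp
    qed
  qed (use fin f(1) sum in auto)
  then show ?thesis using that[of \<sigma> y] \<sigma> y by blast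
qed

section \<open>The theorem\<close>

theorem theorem3:
  fixes d m :: nat
    and W :: "'w set"
    and K L :: "'w set set"
    and X :: "'w \<Rightarrow> nat \<Rightarrow> (nat \<Rightarrow> real)"
    and A :: "'w \<Rightarrow> nat \<Rightarrow> (nat \<Rightarrow> real) set"
  assumes "0 < d" and "0 < m" and "finite W"
    and "admissible_selection_structure d W K L"
    and "\<And>w i. w \<in> W \<Longrightarrow> i \<in> {1..m} \<Longrightarrow> X w i \<in> topspace (Euclidean_space (d - 1))"
    and "\<And>w i. w \<in> W \<Longrightarrow> i \<in> {1..m} \<Longrightarrow> closedin (nsphere d) (A w i)"
    and "\<And>W'. W' \<subseteq> W \<Longrightarrow> W - W' \<notin> L \<Longrightarrow>
           topspace (nsphere d) = (\<Union>w\<in>W'. \<Union>i\<in>{1..m}. A w i \<union> uminus ` A w i)"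
    and "\<And>u w i. u \<in> W \<Longrightarrow> w \<in> W \<Longrightarrow> u \<noteq> w \<Longrightarrow> {u, w} \<in> K \<Longrightarrow> i \<in> {1..m} \<Longrightarrow>
           A u i \<inter> uminus ` A w i = {}"
  shows "\<exists>x \<in> topspace (nsphere d). \<exists>P Q :: ('w \<times> nat) set.
           P \<noteq> {} \<and> Q \<noteq> {} \<and> P \<inter> Q = {} \<and> P \<subseteq> W \<times> {1..m} \<and> Q \<subseteq> W \<times> {1..m} \<and>
           convex hull {X w i | w i. (w, i) \<in> P} \<inter> convex hull {X w i | w i. (w, i) \<in> Q} \<noteq> {} \<and>
           x \<in> (\<Inter>(w, i)\<in>P. A w i) \<inter> (\<Inter>(w, i)\<in>Q. uminus ` A w i) \<and>
           inj_on fst (P \<union> Q) \<and> fst ` (P \<union> Q) \<in> facets K \<and>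
           snd ` P \<inter> snd ` Q = {}"
proof -
  note W = \<open>finite W\<close> and adm = \<open>admissible_selection_structure d W K L\<close>
  note cover = assms(7) and disjoint = assms(8)
  have facets: "\<forall>U\<in>L. facets (induced_complex K U) \<subseteq> facets K"
    using adm unfolding admissible_selection_structure_def by (elim conjE)
  have "simplicial_complex_on W K"
    using adm unfolding admissible_selection_structure_def by (elim conjE)
  then have K: "K \<subseteq> Pow W" "\<And>\<sigma> \<tau>. \<sigma> \<in> K \<Longrightarrow> \<tau> \<subseteq> \<sigma> \<Longrightarrow> \<tau> \<in> K"
    unfolding simplicial_complex_on_def by blast+
  define C where "C Z = topspace (geometric_realization (fiber_complex K W (active_labels m A Z)))" for Z
  have C_mono: "C S \<subseteq> C T" if "\<And>w. w \<in> W \<Longrightarrow> active_labels m A S w \<subseteq> active_labels m A T w" for S T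
    unfolding C_def using that by (intro topspace_geometric_realization_mono fiber_complex_mono)
  have usc: "\<exists>V. openin (nsphere d) V \<and> x \<in> V \<and> C V \<subseteq> C {x}"
    if x: "x \<in> topspace (nsphere d)" for x
  proof -
    have "\<exists>V. openin (nsphere d) V \<and> x \<in> V \<and>
        (\<forall>w\<in>W. active_labels m A V w \<subseteq> active_labels m A {x} w)"
      using W assms(6) x by (rule active_labels_upper_semicontinuous)
    then obtain V where V: "openin (nsphere d) V" "x \<in> V"
      and labels: "\<forall>w\<in>W. active_labels m A V w \<subseteq> active_labels m A {x} w"
      by blast
    have "C V \<subseteq> C {x}" by (rule C_mono) (rule bspec[OF labels])
    then show ?thesis using V(1,2) by (intro exI[of _ V] conjI)
  qed
  have conn: "n_connected (d - 1) (subtopology (powertop_real UNIV) (C S))"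
    if "S \<subseteq> topspace (nsphere d)" "S \<noteq> {}" for S
    unfolding C_def geometric_realization_subtopology
  proof (rule fiber_complex_connected[OF adm])
    show "finite (active_labels m A S w)" for w
      by (rule finite_subset[OF _ finite_signed_labels[of m]]) (auto simp: active_labels_def)
    show "{w \<in> W. active_labels m A S w \<noteq> {}} \<in> L"
      using adm cover that by (rule active_labels_in_family)
  qed
  obtain x f where x: "x \<in> topspace (nsphere d)" and f: "f \<in> C {x}" and zero: "signed_moment d m W X f = 0"
  proof -
    note chosen = that
    show ?thesis
    proof (rule borsuk_ulam_carrier[where d = d and Y = "powertop_real UNIV" and b = flip_fiber and C = C
          and F = "signed_moment d m W X"])
      show "C S \<subseteq> C T" if "S \<subseteq> T" for S T
        by (rule C_mono) (rule active_labels_mono[OF that])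
      show "flip_fiber ` C S \<subseteq> C (uminus ` S)" for S
        unfolding C_def
        by (rule flip_fiber_geometric_realization) (rule active_labels_antipode)
      show "flip_fiber (flip_fiber f) = f" for f :: "'w \<times> nat \<Rightarrow> real"
        by (simp add: flip_fiber_def fun_eq_iff)
      show "continuous_map (powertop_real UNIV) (Euclidean_space d) (signed_moment d m W X)"
        using assms(1) W assms(5) by (rule continuous_map_signed_moment)
      show ?thesis if "x \<in> topspace (nsphere d)" "f \<in> topspace (powertop_real UNIV) \<inter> C {x}"
        "signed_moment d m W X f = 0" for x f
        using that by (intro chosen) simp_all
      show "signed_moment d m W X (flip_fiber f) = - signed_moment d m W X f" for f
        by (rule signed_moment_flip_fiber)
    qed (fact assms(1) continuous_map_flip_fiber conn usc)+
  qed
  let ?D = "active_labels m A {x}"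
  have D: "?D w \<subseteq> {n. n div 2 \<in> {1..m}}" for w by (auto simp: active_labels_def)
  obtain \<sigma> y where \<sigma>: "\<sigma> \<in> induced_complex K W" and y: "\<And>w. w \<in> \<sigma> \<Longrightarrow> y w \<in> ?D w"
    and hulls: "convex hull ((\<lambda>w. X w (y w div 2)) ` {w \<in> \<sigma>. even (y w)}) \<inter>
     convex hull ((\<lambda>w. X w (y w div 2)) ` {w \<in> \<sigma>. odd (y w)}) \<noteq> {}"
  proof -
    note chosen = that
    show ?thesis
    proof (rule signed_moment_zero_imp_hulls_meet[of d W m X ?D f K])
      show "X w i \<in> topspace (Euclidean_space (d - 1))" if "w \<in> W" "i \<in> {1..m}" for w i
        using assms(5) that .
      show "f \<in> topspace (geometric_realization (fiber_complex K W ?D))" using f by (simp add: C_def)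
      show "?D w \<subseteq> {n. n div 2 \<in> {1..m}}" for w by (rule D)
      show ?thesis if "\<sigma> \<in> induced_complex K W" "\<And>w. w \<in> \<sigma> \<Longrightarrow> y w \<in> ?D w"
        "convex hull ((\<lambda>w. X w (y w div 2)) ` {w \<in> \<sigma>. even (y w)}) \<inter>
         convex hull ((\<lambda>w. X w (y w div 2)) ` {w \<in> \<sigma>. odd (y w)}) \<noteq> {}" for \<sigma> y
        by (rule chosen[of \<sigma> y]) (fact that)+
    qed (use assms(1) W zero in simp_all)
  qed
  let ?T = "{w \<in> W. ?D w \<noteq> {}}"
  have "{x} \<subseteq> topspace (nsphere d)" "{x} \<noteq> {}" using x by simp_all
  with adm cover have T: "?T \<in> L" by (rule active_labels_in_family)
  have "\<sigma> \<subseteq> ?T"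
  proof
    fix w assume w: "w \<in> \<sigma>"
    then have "w \<in> W" using \<sigma> unfolding induced_complex_def by blast
    moreover have "?D w \<noteq> {}" using y[OF w] by blast
    ultimately show "w \<in> ?T" by simp
  qed
  then have face: "\<sigma> \<in> induced_complex K ?T" using \<sigma> by (simp add: induced_complex_def)
  have "induced_complex K ?T \<subseteq> Pow W"
    by (rule subset_trans[OF _ K(1)]) (simp add: induced_complex_def)
  from ex_facet_superset[OF W this face]
  obtain \<tau> where \<tau>: "\<tau> \<in> facets (induced_complex K ?T)" "\<sigma> \<subseteq> \<tau>" .
  have \<tau>K: "\<tau> \<in> facets K" using bspec[OF facets T] \<tau>(1) by (rule subsetD)
  have \<tau>T: "\<tau> \<in> K" "\<tau> \<subseteq> ?T" using \<tau>(1) by (simp_all add: facets_def induced_complex_def)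
  \<comment> \<open>the given labels on the face, arbitrary active labels on the rest of the facet\<close>
  define y' where "y' w = (if w \<in> \<sigma> then y w else (SOME n. n \<in> ?D w))" for w
  have y': "y' w \<in> ?D w" if "w \<in> \<tau>" for w
  proof (cases "w \<in> \<sigma>")
    case True
    then show ?thesis using y by (simp add: y'_def)
  next
    case False
    have "?D w \<noteq> {}" using that \<tau>T(2) by blast
    then show ?thesis using False by (simp add: y'_def some_in_eq)
  qed
  define P where "P = (\<lambda>w. (w, y' w div 2)) ` {w \<in> \<tau>. even (y' w)}"
  define Q where "Q = (\<lambda>w. (w, y' w div 2)) ` {w \<in> \<tau>. odd (y' w)}"
  have PQ: "P \<union> Q = (\<lambda>w. (w, y' w div 2)) ` \<tau>" by (auto simp: P_def Q_def)
  have "y' w div 2 \<in> {1..m}" "x \<in> signed_set A w (y' w)" if "w \<in> \<tau>" for w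
    using y'[OF that] by (simp_all add: active_labels_def)
  note label = this
  have "P \<union> Q \<subseteq> W \<times> {1..m}" unfolding PQ using \<tau>T(2) label(1) by blast
  then have sub: "P \<subseteq> W \<times> {1..m}" "Q \<subseteq> W \<times> {1..m}" by simp_all
  have in_P: "x \<in> A w i" if "(w, i) \<in> P" for w i
  proof -
    have "w \<in> \<tau>" "even (y' w)" "i = y' w div 2" using that by (auto simp: P_def)
    then show ?thesis using label(2)[of w] by (simp add: signed_set_def)
  qed
  have in_Q: "x \<in> uminus ` A w i" if "(w, i) \<in> Q" for w i
  proof -
    have "w \<in> \<tau>" "odd (y' w)" "i = y' w div 2" using that by (auto simp: Q_def)
    then show ?thesis using label(2)[of w] by (simp add: signed_set_def)
  qed
  have "(w, y w div 2) \<in> P" if "w \<in> \<sigma>" "even (y w)" for w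
    unfolding P_def by (rule image_eqI[of _ _ w]) (use that \<tau>(2) in \<open>auto simp: y'_def\<close>)
  then have hull_P: "(\<lambda>w. X w (y w div 2)) ` {w \<in> \<sigma>. even (y w)} \<subseteq> {X w i | w i. (w, i) \<in> P}"
    by blast
  have "(w, y w div 2) \<in> Q" if "w \<in> \<sigma>" "odd (y w)" for w
    unfolding Q_def by (rule image_eqI[of _ _ w]) (use that \<tau>(2) in \<open>auto simp: y'_def\<close>)
  then have hull_Q: "(\<lambda>w. X w (y w div 2)) ` {w \<in> \<sigma>. odd (y w)} \<subseteq> {X w i | w i. (w, i) \<in> Q}"
    by blast
  have meet: "convex hull {X w i | w i. (w, i) \<in> P} \<inter> convex hull {X w i | w i. (w, i) \<in> Q} \<noteq> {}"
    using hulls hull_mono[OF hull_P, of convex] hull_mono[OF hull_Q, of convex] by blast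
  have nonempty: "P \<noteq> {}" "Q \<noteq> {}"
  proof -
    show "P \<noteq> {}"
    proof
      assume "P = {}"
      then show False using meet by simp
    qed
    show "Q \<noteq> {}"
    proof
      assume "Q = {}"
      then show False using meet by simp
    qed
  qed
  have disjnt: "P \<inter> Q = {}" by (auto simp: P_def Q_def)
  have inj: "inj_on fst (P \<union> Q)" unfolding PQ by (auto simp: inj_on_def)
  have proj: "fst ` (P \<union> Q) \<in> facets K" unfolding PQ using \<tau>K by (simp add: image_image)
  have indices: "snd ` P \<inter> snd ` Q = {}"
  proof (rule ccontr)
    assume "snd ` P \<inter> snd ` Q \<noteq> {}"
    then obtain i where "i \<in> snd ` P" "i \<in> snd ` Q" by blast
    then obtain u w where ui: "(u, i) \<in> P" and wi: "(w, i) \<in> Q" by (elim imageE) auto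
    then have u: "u \<in> \<tau>" "even (y' u)" and w: "w \<in> \<tau>" "odd (y' w)" by (auto simp: P_def Q_def)
    then have "u \<noteq> w" by blast
    moreover have "{u, w} \<in> K" using K(2)[OF \<tau>T(1), of "{u, w}"] u w by simp
    moreover have "u \<in> W" "w \<in> W" "i \<in> {1..m}" using ui wi sub by blast+
    ultimately have "A u i \<inter> uminus ` A w i = {}" by (intro disjoint)
    then show False using in_P[OF ui] in_Q[OF wi] by blast
  qed
  have point: "x \<in> (\<Inter>(w, i)\<in>P. A w i) \<inter> (\<Inter>(w, i)\<in>Q. uminus ` A w i)"
    using in_P in_Q by blast
  show ?thesis
    by (intro bexI[OF _ x] exI[of _ P] exI[of _ Q] conjI nonempty disjnt sub meet point inj proj indices)
qed

end
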